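(* Let $\eta_i=m_i+\varepsilon_i$, $i=1,\dots,n$, be observations in a real, separable, infinite dimensional Hilbert space $H$ following the signal plus noise model described in the context, let $d\in\mathbb{N}$, and let $\hat{\mathscr{C}}=\hat{\mathscr{C}}_n$ be estimates of the long run covariance operator $\mathscr{C}$ which are self-adjoint Hilbert-Schmidt operators. Assume: (i) $\|\mathscr{C}-\hat{\mathscr{C}}\|_{\mathcal S}=o_P(1)$ as $n\to\infty$; (ii) $\lambda_d>\lambda_{d+1}$, where $\lambda_1\ge\lambda_2\ge\dots\ge0$ are the eigenvalues of $\mathscr{C}$; (iii) under $H_0$, $\mathscr{T}^{(d)}\stackrel{\mathscr{D}}{\longrightarrow}\sup_{0\le x\le1}\big(\sum_{1\le r\le d}\mathscr{B}_r^2(x)\big)^{1/2}$ as $n\to\infty$; (iv) $\max_{1\le k<n}\|S_k(\varepsilon)\|=\mathcal{O}_P(1)$ as $n\to\infty$. Then under $H_0$, as $n\to\infty$, $$\hat{\mathscr{T}}^{(d)}\stackrel{\mathscr{D}}{\longrightarrow}\sup_{0\le x\le1}\Big(\sum_{1\le r\le d}\mathscr{B}_r^2(x)\Big)^{1/2}.$$ Here $\{\mathscr{B}_r(x),x\in[0,1]\}$, $r=1,\dots,d$, are independent standard Brownian bridges.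
   Context: Model. $\eta_i=m_i+\varepsilon_i$ with $m_i=g(i/n)\Delta$, $i=1,\dots,n$, where $\Delta\in H$, $\|\Delta\|=1$, $g:[0,1]\to\mathbb{R}$ is piecewise Lipschitz continuous, and $\{\varepsilon_i\}_{i\in\mathbb{Z}}$ is a centered, strictly stationary $H$-valued time series with $E\|\varepsilon_1\|^2<\infty$. The null hypothesis $H_0$ is that $g$ is constant on $[0,1]$. Operators. $(x\otimes y)z=\langle y,z\rangle x$; $\|\cdot\|_{\mathcal S}$ is the Hilbert-Schmidt norm; $\mathscr{C}_h=E[\varepsilon_0\otimes\varepsilon_h]$ with $\sum_{h\in\mathbb{Z}}\|\mathscr{C}_h\|_{\mathcal S}<\infty$, and $\mathscr{C}=\sum_{h\in\mathbb{Z}}\mathscr{C}_h$ (a positive self-adjoint Hilbert-Schmidt operator). Spectral decompositions: $\mathscr{C}=\sum_j\lambda_j(v_j\otimes v_j)$, $\hat{\mathscr{C}}=\sum_j\hat\lambda_j(\hat v_j\otimes\hat v_j)$, with real eigenvalues in decreasing order ($\lambda_j\ge0$; the $\hat\lambda_j$ are not assumed non-negative) and orthonormal bases $\{v_j\}$, $\{\hat v_j\}$ of $H$. It is assumed that $\lambda_d>0$. Statistics. For a (Hilbert space or $\mathbb{R}^d$ valued) series $x_1,\dots,x_n$ put $S_k(x)=n^{-1/2}\sum_{i=1}^k(x_i-\bar x_n)$, $\bar x_n=n^{-1}\sum_{i=1}^nx_i$. Let $\boldsymbol{\eta}_i=[\langle\eta_i,v_1\rangle,\dots,\langle\eta_i,v_d\rangle]'$,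 $\hat{\boldsymbol{\eta}}_i=[\langle\eta_i,\hat v_1\rangle,\dots,\langle\eta_i,\hat v_d\rangle]'$, $\Sigma=\operatorname{diag}(\lambda_1,\dots,\lambda_d)$, $\hat\Sigma=\operatorname{diag}(|\hat\lambda_1|,\dots,|\hat\lambda_d|)$, and, with $|\cdot|$ the Euclidean norm, $$\mathscr{T}^{(d)}=\max_{1\le k<n}|\Sigma^{-1/2}S_k(\boldsymbol{\eta})|,\qquad \hat{\mathscr{T}}^{(d)}=\max_{1\le k<n}|\hat\Sigma^{-1/2}S_k(\hat{\boldsymbol{\eta}})|,$$ where $\hat{\mathscr{T}}^{(d)}:=\infty$ if $\hat\lambda_j=0$ for some $1\le j\le d$. *)

theory Defs
  imports "HOL-Probability.Probability"
begin

section \<open>Operators on a separable Hilbert space\<close>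

definition tensor_op :: "'h::real_inner \<Rightarrow> 'h \<Rightarrow> 'h \<Rightarrow> 'h" where
  "tensor_op x y = (\<lambda>z. (y \<bullet> z) *\<^sub>R x)"

text \<open>Orthonormal bases are sequences indexed from 0, so \<open>e j\<close> is the basis vector
  with index \<open>j + 1\<close> in 1-based notation; likewise for eigenvalues below.\<close>

definition orthonormal_basis :: "(nat \<Rightarrow> 'h::real_inner) \<Rightarrow> bool" where
  "orthonormal_basis e \<longleftrightarrow>
     (\<forall>i j. e i \<bullet> e j = (if i = j then 1 else 0)) \<and> closure (span (range e)) = UNIV"

definition hilbert_schmidt :: "('h::real_inner \<Rightarrow> 'h) \<Rightarrow> bool" where
  "hilbert_schmidt A \<longleftrightarrow>
     bounded_linear A \<and> (\<forall>e. orthonormal_basis e \<longrightarrow> summable (\<lambda>j. (norm (A (e j)))\<^sup>2))"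

text \<open>The Hilbert-Schmidt norm does not depend on the orthonormal basis used to compute it.
  It is meaningful for Hilbert-Schmidt operators only.\<close>

definition hs_norm :: "('h::real_inner \<Rightarrow> 'h) \<Rightarrow> real" where
  "hs_norm A = (let e = (SOME e. orthonormal_basis e) in sqrt (\<Sum>j. (norm (A (e j)))\<^sup>2))"

definition self_adjoint :: "('h::real_inner \<Rightarrow> 'h) \<Rightarrow> bool" where
  "self_adjoint A \<longleftrightarrow> (\<forall>x y. A x \<bullet> y = x \<bullet> A y)"

definition spectral_decomposition ::
    "('h::real_inner \<Rightarrow> 'h) \<Rightarrow> (nat \<Rightarrow> real) \<Rightarrow> (nat \<Rightarrow> 'h) \<Rightarrow> bool" where
  "spectral_decomposition A lam v \<longleftrightarrow>
     orthonormal_basis v \<and> (\<forall>x. (\<lambda>j. lam j *\<^sub>R tensor_op (v j) (v j) x) sums A x)"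

text \<open>Decreasing order of the leading \<open>m\<close> terms: \<open>f 0 \<ge> \<dots> \<ge> f (m - 1)\<close>, and none of the later
  terms exceeds these. A sequence that is decreasing altogether satisfies this for every \<open>m\<close>.
  An eigenbasis of the whole space cannot in general be enumerated with the eigenvalues decreasing
  altogether: eigenvalues of a Hilbert-Schmidt operator tend to 0, so an eigenvalue 0 would
  never be reached after infinitely many positive ones, and a negative one never at all.\<close>

definition decreasing_upto :: "nat \<Rightarrow> (nat \<Rightarrow> real) \<Rightarrow> bool" where
  "decreasing_upto m f \<longleftrightarrow> (\<forall>i<m. \<forall>j\<ge>i. f j \<le> f i)"

text \<open>Ordering of the eigenvalues of an operator that need not be positive. In infinite
  dimension the first alternative implies that the leading \<open>m\<close> eigenvalues are non-negative, and
  it is unattainable for operators with fewer than \<open>m\<close> non-negative eigenvalues. The second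
  alternative (order by modulus) is attainable for every self-adjoint Hilbert-Schmidt operator and
  admits negative leading eigenvalues. The two agree for positive operators. Either one is
  allowed.\<close>

definition eigenvalue_order :: "nat \<Rightarrow> (nat \<Rightarrow> real) \<Rightarrow> bool" where
  "eigenvalue_order m lam \<longleftrightarrow>
     decreasing_upto m lam \<or> decreasing_upto m (\<lambda>j. \<bar>lam j\<bar>)"

section \<open>Model\<close>

definition strictly_stationary :: "'w measure \<Rightarrow> (int \<Rightarrow> 'w \<Rightarrow> 'h::topological_space) \<Rightarrow> bool" where
  "strictly_stationary M \<epsilon> \<longleftrightarrow>
     (\<forall>J h. finite J \<longrightarrow>
        distr M (\<Pi>\<^sub>M j\<in>J. borel) (\<lambda>\<omega>. \<lambda>j\<in>J. \<epsilon> (j + h) \<omega>) =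
        distr M (\<Pi>\<^sub>M j\<in>J. borel) (\<lambda>\<omega>. \<lambda>j\<in>J. \<epsilon> j \<omega>))"

text \<open>No condition is imposed on the values at the finitely many break points.\<close>

definition piecewise_lipschitz :: "(real \<Rightarrow> real) \<Rightarrow> bool" where
  "piecewise_lipschitz g \<longleftrightarrow>
     (\<exists>m t. t 0 = 0 \<and> t m = 1 \<and>
        (\<forall>i<m. t i < t (Suc i) \<and> (\<exists>L. L-lipschitz_on {t i<..<t (Suc i)} g)))"

text \<open>The observation with index \<open>i \<in> {1..n}\<close> in the sample of size \<open>n\<close>.\<close>

definition observation ::
    "(real \<Rightarrow> real) \<Rightarrow> 'h::real_vector \<Rightarrow> (int \<Rightarrow> 'w \<Rightarrow> 'h) \<Rightarrow> nat \<Rightarrow> nat \<Rightarrow> 'w \<Rightarrow> 'h" where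
  "observation g \<Delta> \<epsilon> n i \<omega> = g (real i / real n) *\<^sub>R \<Delta> + \<epsilon> (int i) \<omega>"

text \<open>The operator-valued expectation of \<open>\<epsilon>\<^sub>0 \<otimes> \<epsilon>\<^sub>h\<close>, evaluated at a vector.\<close>

definition autocov_op ::
    "'w measure \<Rightarrow> (int \<Rightarrow> 'w \<Rightarrow> 'h::{real_inner, banach, second_countable_topology})
      \<Rightarrow> int \<Rightarrow> 'h \<Rightarrow> 'h" where
  "autocov_op M \<epsilon> h = (\<lambda>x. \<integral>\<omega>. tensor_op (\<epsilon> 0 \<omega>) (\<epsilon> h \<omega>) x \<partial>M)"

text \<open>If the Hilbert-Schmidt norms of the autocovariance operators are summable, this pointwise
  sum coincides with the sum in the space of Hilbert-Schmidt operators.\<close>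

definition long_run_cov_op ::
    "'w measure \<Rightarrow> (int \<Rightarrow> 'w \<Rightarrow> 'h::{real_inner, banach, second_countable_topology})
      \<Rightarrow> 'h \<Rightarrow> 'h" where
  "long_run_cov_op M \<epsilon> = (\<lambda>x. \<Sum>\<^sub>\<infinity>h. autocov_op M \<epsilon> h x)"

section \<open>Statistics\<close>

text \<open>\<open>S\<^sub>k(x)\<close> for the series \<open>x 1, \<dots>, x n\<close>.\<close>

definition cusum :: "nat \<Rightarrow> nat \<Rightarrow> (nat \<Rightarrow> 'a::real_vector) \<Rightarrow> 'a" where
  "cusum n k x = (1 / sqrt (real n)) *\<^sub>R
     (\<Sum>i=1..k. x i - (1 / real n) *\<^sub>R (\<Sum>l=1..n. x l))"

text \<open>Maximum over \<open>1 \<le> k < n\<close> of the Euclidean norm of \<open>\<Sigma>\<^sup>-\<^sup>1\<^sup>/\<^sup>2 S\<^sub>k\<close>, where \<open>S\<^sub>k\<close> is formed from the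
  score vectors with components \<open>x i \<bullet> v j\<close>, \<open>j < d\<close>, and \<open>\<Sigma> = diag(lam 0, \<dots>, lam (d - 1))\<close>;
  \<open>S\<^sub>k\<close> acts componentwise. For \<open>n < 2\<close> there is no such \<open>k\<close> and the value is unspecified.\<close>

definition proj_statistic ::
    "nat \<Rightarrow> (nat \<Rightarrow> real) \<Rightarrow> (nat \<Rightarrow> 'h::real_inner) \<Rightarrow> nat \<Rightarrow> (nat \<Rightarrow> 'h) \<Rightarrow> real" where
  "proj_statistic d lam v n x =
     Max ((\<lambda>k. L2_set (\<lambda>j. cusum n k (\<lambda>i. x i \<bullet> v j) / sqrt (lam j)) {..<d}) ` {1..<n})"

definition proj_statistic_hat ::
    "nat \<Rightarrow> (nat \<Rightarrow> real) \<Rightarrow> (nat \<Rightarrow> 'h::real_inner) \<Rightarrow> nat \<Rightarrow> (nat \<Rightarrow> 'h) \<Rightarrow> ereal" where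
  "proj_statistic_hat d lamh vh n x =
     (if \<exists>j<d. lamh j = 0 then \<infinity> else ereal (proj_statistic d (\<lambda>j. \<bar>lamh j\<bar>) vh n x))"

section \<open>Stochastic convergence\<close>

definition little_oP_1 :: "'w measure \<Rightarrow> (nat \<Rightarrow> 'w \<Rightarrow> real) \<Rightarrow> bool" where
  "little_oP_1 M X \<longleftrightarrow>
     (\<forall>\<delta>>0. (\<lambda>n. measure M {\<omega> \<in> space M. \<bar>X n \<omega>\<bar> > \<delta>}) \<longlonglongrightarrow> 0)"

definition big_OP_1 :: "'w measure \<Rightarrow> (nat \<Rightarrow> 'w \<Rightarrow> real) \<Rightarrow> bool" where
  "big_OP_1 M X \<longleftrightarrow>
     (\<forall>\<delta>>0. \<exists>K. \<forall>\<^sub>F n in sequentially. measure M {\<omega> \<in> space M. \<bar>X n \<omega>\<bar> > K} < \<delta>)"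

text \<open>Convergence in distribution to a real random variable, by convergence of distribution
  functions at all continuity points as in \<^const>\<open>weak_conv_m\<close>, for variables that may take
  infinite values. As the limit is finite, no mass can escape to infinity.\<close>

definition conv_in_distribution ::
    "'w measure \<Rightarrow> (nat \<Rightarrow> 'w \<Rightarrow> ereal) \<Rightarrow> 'b measure \<Rightarrow> ('b \<Rightarrow> real) \<Rightarrow> bool" where
  "conv_in_distribution M X N Y \<longleftrightarrow>
     weak_conv (\<lambda>n t. measure M {\<omega> \<in> space M. X n \<omega> \<le> ereal t}) (cdf (distr N borel Y))"

section \<open>Brownian bridges\<close>

text \<open>Normal variables, including the degenerate ones.\<close>

definition normal_variable :: "'b measure \<Rightarrow> ('b \<Rightarrow> real) \<Rightarrow> bool" where
  "normal_variable N X \<longleftrightarrow> X \<in> borel_measurable N \<and>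
     ((\<exists>c. AE \<omega> in N. X \<omega> = c) \<or>
      (\<exists>\<mu> \<sigma>. 0 < \<sigma> \<and> distributed N lborel X (normal_density \<mu> \<sigma>)))"

definition gaussian_process :: "'b measure \<Rightarrow> 't set \<Rightarrow> ('t \<Rightarrow> 'b \<Rightarrow> real) \<Rightarrow> bool" where
  "gaussian_process N T X \<longleftrightarrow>
     (\<forall>J a. finite J \<and> J \<subseteq> T \<longrightarrow> normal_variable N (\<lambda>\<omega>. \<Sum>t\<in>J. a t * X t \<omega>))"

definition brownian_bridge :: "'b measure \<Rightarrow> (real \<Rightarrow> 'b \<Rightarrow> real) \<Rightarrow> bool" where
  "brownian_bridge N B \<longleftrightarrow>
     gaussian_process N {0..1} B \<and>
     (\<forall>t\<in>{0..1}. (\<integral>\<omega>. B t \<omega> \<partial>N) = 0) \<and>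
     (\<forall>s\<in>{0..1}. \<forall>t\<in>{0..1}. (\<integral>\<omega>. B s \<omega> * B t \<omega> \<partial>N) = min s t - s * t) \<and>
     (\<forall>\<omega>\<in>space N. continuous_on {0..1} (\<lambda>t. B t \<omega>))"

text \<open>Independence of the processes as random elements of the space of functions on \<open>[0,1]\<close>.\<close>

definition independent_brownian_bridges ::
    "'b measure \<Rightarrow> nat \<Rightarrow> (nat \<Rightarrow> real \<Rightarrow> 'b \<Rightarrow> real) \<Rightarrow> bool" where
  "independent_brownian_bridges N d B \<longleftrightarrow>
     (\<forall>r<d. brownian_bridge N (B r)) \<and>
     prob_space.indep_vars N (\<lambda>r. \<Pi>\<^sub>M t\<in>{0..1}. borel) (\<lambda>r \<omega>. \<lambda>t\<in>{0..1}. B r t \<omega>) {..<d}"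

definition bridge_sup :: "nat \<Rightarrow> (nat \<Rightarrow> real \<Rightarrow> 'b \<Rightarrow> real) \<Rightarrow> 'b \<Rightarrow> real" where
  "bridge_sup d B \<omega> = (SUP x\<in>{0..1}. sqrt (\<Sum>r<d. (B r x \<omega>)\<^sup>2))"

end

theory Submission
  imports Defs
begin

text \<open>The statistic \<open>\<T>\<close> depends on the operator \<open>\<C>\<close> only through the truncated inverse
\<open>Q = \<Sum>\<^sub>j\<^sub><\<^sub>d \<lambda>\<^sub>j\<^sup>-\<^sup>1 v\<^sub>j \<otimes> v\<^sub>j\<close>: for a vector \<open>z\<close>, the squared norm of the standardized
scores of \<open>z\<close> is \<open>\<langle>z, Q z\<rangle>\<close>. This form does not see the choice of signs, nor the choice of a basis
inside an eigenspace of a multiple eigenvalue, so no consistency of individual eigenvectors is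
required; the gap \<open>\<lambda>\<^sub>d > \<lambda>\<^sub>d\<^sub>+\<^sub>1\<close> is enough. The estimated statistic is given in the same way by an
estimated operator \<open>Q'\<close>.

Both the location of the estimated eigenvalues and the closeness of \<open>Q'\<close> to \<open>Q\<close> come from one
identity. If \<open>A = \<Sum> a\<^sub>i u\<^sub>i \<otimes> u\<^sub>i\<close> and \<open>B = \<Sum> b\<^sub>j w\<^sub>j \<otimes> w\<^sub>j\<close>, then
\<open>\<langle>w\<^sub>j, (A - B) u\<^sub>i\<rangle> = (a\<^sub>i - b\<^sub>j) \<langle>w\<^sub>j, u\<^sub>i\<rangle>\<close> (\<open>inner_eigenvectors_diff\<close>). Taking squares and summing
with Parseval's identity, one finds that when \<open>A - B\<close> has small Hilbert-Schmidt norm, at most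
\<open>card J\<close> of the \<open>a\<^sub>i\<close> can be far from every \<open>b\<^sub>j\<close> with \<open>j \<notin> J\<close>
(\<open>separated_eigenvalues_card\<close>). Hence, once
the error is below half of the gap, exactly the first \<open>d\<close> estimated eigenvalues lie above the
midpoint of the gap (\<open>leading_eigenvalues_located\<close>). The same identity applied to \<open>Q\<close> and \<open>Q'\<close>
shows that \<open>\<parallel>(Q - Q') v\<^sub>i\<parallel> \<le> K \<parallel>(A - B) v\<^sub>i\<parallel>\<close> as soon as the map from an eigenvalue to its reciprocal
above the gap, and to 0 below it, is \<open>K\<close>-Lipschitz on the eigenvalues that occur
(\<open>diag_op_diff_norm_le\<close>). So the standardized scores of \<open>z\<close> change by at most a constant times the
root of the Hilbert-Schmidt error times \<open>\<parallel>z\<parallel>\<close> (\<open>standardized_scores_perturbation\<close>).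

Under the null hypothesis the signal cancels in the partial sums, so that \<open>z = S\<^sub>k(\<epsilon>)\<close>; these are
bounded in probability and the error tends to 0 in probability. Thus the two statistics differ by
a quantity that tends to 0 in probability, and \<open>weak_conv_perturbation\<close> (Slutsky) transfers the
limit. The Hilbert-Schmidt norm of the error is informative only because \<open>\<C>\<close> is itself a
Hilbert-Schmidt operator, which follows from the summability of the norms of the autocovariance
operators (\<open>long_run_cov_op_hilbert_schmidt\<close>).\<close>

section \<open>Orthonormal systems\<close>

definition orthonormal :: "(nat \<Rightarrow> 'h::real_inner) \<Rightarrow> bool" where
  "orthonormal u \<longleftrightarrow> (\<forall>i j. u i \<bullet> u j = (if i = j then 1 else 0))"

lemma orthonormal_basis_orthonormal: "orthonormal_basis e \<Longrightarrow> orthonormal e"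
  by (simp add: orthonormal_basis_def orthonormal_def)

lemma orthonormal_norm [simp]: "orthonormal u \<Longrightarrow> norm (u i) = 1"
  by (simp add: orthonormal_def norm_eq_1)

lemma orthonormal_residual:
  assumes "orthonormal u" "finite F"
  shows "(norm (x - (\<Sum>i\<in>F. (u i \<bullet> x) *\<^sub>R u i)))\<^sup>2 = (norm x)\<^sup>2 - (\<Sum>i\<in>F. (u i \<bullet> x)\<^sup>2)"
proof -
  let ?P = "\<Sum>i\<in>F. (u i \<bullet> x) *\<^sub>R u i"
  have u: "u i \<bullet> u j = (if i = j then 1 else 0)" for i j
    using assms(1) by (simp add: orthonormal_def)
  have "x \<bullet> ?P = (\<Sum>i\<in>F. (u i \<bullet> x)\<^sup>2)"
    by (simp add: inner_sum_right power2_eq_square inner_commute)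
  moreover have "?P \<bullet> ?P = (\<Sum>i\<in>F. (u i \<bullet> x)\<^sup>2)"
    using assms(2) by (simp add: inner_sum_right inner_sum_left u if_distrib power2_eq_square
        sum.delta cong: if_cong)
  ultimately show ?thesis
    by (simp add: power2_norm_eq_inner inner_diff_left inner_diff_right inner_commute)
qed

lemma bessel_inequality:
  assumes "orthonormal u" "finite F"
  shows "(\<Sum>i\<in>F. (u i \<bullet> x)\<^sup>2) \<le> (norm x)\<^sup>2"
  using orthonormal_residual[OF assms, of x] zero_le_power2[of "norm (x - (\<Sum>i\<in>F. (u i \<bullet> x) *\<^sub>R u i))"]
  by linarith

text \<open>The residual of a partial sum is never longer than \<open>x\<close>, and it vanishes for a vector of the
span of the basis once the sum is long enough. As the span is dense, the residuals tend to 0.\<close>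

lemma orthonormal_basis_expansion:
  assumes "orthonormal_basis e"
  shows "(\<lambda>j. (e j \<bullet> x) *\<^sub>R e j) sums x"
proof -
  define P where "P n y = (\<Sum>i<n. (e i \<bullet> y) *\<^sub>R e i)" for n and y :: 'a
  have o: "orthonormal e"
    using assms by (rule orthonormal_basis_orthonormal)
  have norm_residual: "norm (y - P n y) \<le> norm y" for y n
  proof -
    have "(norm (y - P n y))\<^sup>2 \<le> (norm y)\<^sup>2"
      unfolding P_def using orthonormal_residual[OF o, of "{..<n}" y] by (simp add: sum_nonneg)
    then show ?thesis by (rule power2_le_imp_le) simp
  qed
  have P_add: "P n (y + z) = P n y + P n z" for n y z
    unfolding P_def by (simp only: inner_add_right scaleR_add_left sum.distrib)
  have P_scale: "P n (c *\<^sub>R y) = c *\<^sub>R P n y" for n y c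
    unfolding P_def by (simp only: inner_scaleR_right scaleR_sum_right scaleR_scaleR)
  have P_diff: "P n (y - z) = P n y - P n z" for n y z
    using P_add[of n y "(-1) *\<^sub>R z"] by (simp only: P_scale) simp
  have fixed: "\<forall>\<^sub>F n in sequentially. P n y = y" if "y \<in> span (range e)" for y
    using that
  proof (induction rule: span_induct_alt)
    case (step c a b)
    then obtain k where k: "a = e k" by blast
    have "\<forall>\<^sub>F n in sequentially. P n a = a"
      using eventually_gt_at_top[of k]
    proof eventually_elim
      case (elim n)
      then show ?case
        using o by (simp add: P_def k orthonormal_def if_distrib[where f = "\<lambda>c. c *\<^sub>R _"] cong: if_cong)
    qed
    then show ?case
      using step(2) by eventually_elim (simp add: P_add P_scale)
  next
    case base
    then show ?case by (simp add: P_def)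
  qed
  have "(\<lambda>n. P n x) \<longlonglongrightarrow> x"
  proof (rule LIMSEQ_I)
    fix r :: real assume "0 < r"
    moreover have "x \<in> closure (span (range e))"
      using assms by (simp add: orthonormal_basis_def)
    ultimately obtain y where y: "y \<in> span (range e)" "dist y x < r"
      unfolding closure_approachable by blast
    have "\<forall>\<^sub>F n in sequentially. norm (P n x - x) < r"
      using fixed[OF y(1)]
    proof eventually_elim
      case (elim n)
      then have "x - P n x = (x - y) - P n (x - y)" by (simp add: P_diff)
      then have "norm (x - P n x) \<le> norm (x - y)" using norm_residual by metis
      then show ?case using y(2) by (simp add: dist_norm norm_minus_commute)
    qed
    then show "\<exists>N. \<forall>n\<ge>N. norm (P n x - x) < r" by (simp add: eventually_sequentially)
  qed
  then show ?thesis by (simp add: sums_def P_def)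
qed

lemma parseval:
  assumes "orthonormal_basis e"
  shows "(\<lambda>j. (e j \<bullet> x)\<^sup>2) sums (norm x)\<^sup>2"
  using bounded_linear.sums[OF bounded_linear_inner_left orthonormal_basis_expansion[OF assms], of x x]
  by (simp only: power2_norm_eq_inner) (simp add: power2_eq_square)

section \<open>Hilbert-Schmidt sums of self-adjoint operators\<close>

text \<open>Expand \<open>\<parallel>A u\<^sub>i\<parallel>\<^sup>2\<close> in the basis \<open>e\<close>, move \<open>A\<close> to the other side of the inner product and
apply Bessel's inequality in \<open>u\<close>. In particular the Hilbert-Schmidt sum over one orthonormal basis
bounds the sum over any other.\<close>

lemma sum_norm_image_le:
  assumes A: "self_adjoint A" and e: "orthonormal_basis e" and u: "orthonormal u"
    and S: "summable (\<lambda>j. (norm (A (e j)))\<^sup>2)" and F: "finite F"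
  shows "(\<Sum>i\<in>F. (norm (A (u i)))\<^sup>2) \<le> (\<Sum>j. (norm (A (e j)))\<^sup>2)"
proof -
  have "(\<lambda>j. \<Sum>i\<in>F. (e j \<bullet> A (u i))\<^sup>2) sums (\<Sum>i\<in>F. (norm (A (u i)))\<^sup>2)"
    by (intro sums_sum parseval[OF e])
  moreover have "(\<lambda>j. (norm (A (e j)))\<^sup>2) sums (\<Sum>j. (norm (A (e j)))\<^sup>2)"
    using S by (rule summable_sums)
  moreover have "(\<Sum>i\<in>F. (e j \<bullet> A (u i))\<^sup>2) \<le> (norm (A (e j)))\<^sup>2" for j
    using bessel_inequality[OF u F, of "A (e j)"] A by (simp add: self_adjoint_def inner_commute)
  ultimately show ?thesis by (rule sums_le[rotated])
qed

lemma self_adjoint_norm_le: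
  assumes A: "self_adjoint A" and e: "orthonormal_basis e"
    and S: "\<And>n. (\<Sum>j<n. (norm (A (e j)))\<^sup>2) \<le> K\<^sup>2" and "0 \<le> K"
  shows "norm (A x) \<le> K * norm x"
proof -
  have "(\<lambda>n. \<Sum>j<n. (e j \<bullet> A x)\<^sup>2) \<longlonglongrightarrow> (norm (A x))\<^sup>2"
    using parseval[OF e, of "A x"] by (simp add: sums_def)
  moreover have "(\<Sum>j<n. (e j \<bullet> A x)\<^sup>2) \<le> (K * norm x)\<^sup>2" for n
  proof -
    have "(e j \<bullet> A x)\<^sup>2 \<le> (norm (A (e j)))\<^sup>2 * (norm x)\<^sup>2" for j
    proof -
      have "e j \<bullet> A x = A (e j) \<bullet> x" using A by (simp add: self_adjoint_def)
      then have "\<bar>e j \<bullet> A x\<bar> \<le> norm (A (e j)) * norm x"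
        using Cauchy_Schwarz_ineq2[of "A (e j)" x] by simp
      from power_mono[OF this, of 2] show ?thesis by (simp add: power_mult_distrib)
    qed
    then have "(\<Sum>j<n. (e j \<bullet> A x)\<^sup>2) \<le> (\<Sum>j<n. (norm (A (e j)))\<^sup>2 * (norm x)\<^sup>2)"
      by (intro sum_mono)
    also have "\<dots> = (\<Sum>j<n. (norm (A (e j)))\<^sup>2) * (norm x)\<^sup>2" by (simp add: sum_distrib_right)
    also have "\<dots> \<le> K\<^sup>2 * (norm x)\<^sup>2" by (intro mult_right_mono S) simp
    finally show ?thesis by (simp add: power_mult_distrib)
  qed
  ultimately have "(norm (A x))\<^sup>2 \<le> (K * norm x)\<^sup>2"
    by (intro LIMSEQ_le_const2) auto
  then show ?thesis by (rule power2_le_imp_le) (simp add: \<open>0 \<le> K\<close>)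
qed

definition hs_basis :: "nat \<Rightarrow> 'h::real_inner" where
  "hs_basis = (SOME e. orthonormal_basis e)"

lemma orthonormal_basis_hs_basis:
  assumes "orthonormal_basis (v :: nat \<Rightarrow> 'h::real_inner)"
  shows "orthonormal_basis (hs_basis :: nat \<Rightarrow> 'h)"
  unfolding hs_basis_def by (rule someI[of orthonormal_basis, OF assms])

lemma hs_norm_eq: "hs_norm A = sqrt (\<Sum>j. (norm (A (hs_basis j)))\<^sup>2)"
  by (simp add: hs_norm_def hs_basis_def Let_def)

lemma sum_norm_image_le_hs_norm:
  fixes A :: "'h::real_inner \<Rightarrow> 'h" and e u :: "nat \<Rightarrow> 'h"
  assumes "self_adjoint A" and "orthonormal u" and "finite F"
    and e: "orthonormal_basis e" and S: "\<And>e. orthonormal_basis e \<Longrightarrow> summable (\<lambda>j. (norm (A (e j)))\<^sup>2)"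
  shows "(\<Sum>i\<in>F. (norm (A (u i)))\<^sup>2) \<le> (hs_norm A)\<^sup>2" and "0 \<le> hs_norm A"
proof -
  note b = orthonormal_basis_hs_basis[OF e]
  have "(hs_norm A)\<^sup>2 = (\<Sum>j. (norm (A (hs_basis j)))\<^sup>2)" and "0 \<le> hs_norm A"
    using S[OF b] by (simp_all add: hs_norm_eq suminf_nonneg)
  then show "(\<Sum>i\<in>F. (norm (A (u i)))\<^sup>2) \<le> (hs_norm A)\<^sup>2" and "0 \<le> hs_norm A"
    using sum_norm_image_le[OF assms(1) b assms(2) S[OF b] assms(3)] by simp_all
qed

lemma hilbert_schmidt_sum_diff:
  assumes "summable (\<lambda>j. (norm (A (e j)))\<^sup>2)" "summable (\<lambda>j. (norm (B (e j)))\<^sup>2)"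
  shows "summable (\<lambda>j. (norm (A (e j) - B (e j)))\<^sup>2)"
proof (rule summable_comparison_test')
  show "summable (\<lambda>j. 2 * (norm (A (e j)))\<^sup>2 + 2 * (norm (B (e j)))\<^sup>2)"
    using assms by (intro summable_add summable_mult)
  fix j
  have "(norm (A (e j) - B (e j)))\<^sup>2 \<le> (norm (A (e j)) + norm (B (e j)))\<^sup>2"
    by (intro power_mono norm_triangle_ineq4) simp
  also have "\<dots> \<le> 2 * (norm (A (e j)))\<^sup>2 + 2 * (norm (B (e j)))\<^sup>2"
    using zero_le_power2[of "norm (A (e j)) - norm (B (e j))"] by (simp add: power2_diff power2_sum)
  finally show "norm ((norm (A (e j) - B (e j)))\<^sup>2) \<le> 2 * (norm (A (e j)))\<^sup>2 + 2 * (norm (B (e j)))\<^sup>2"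
    by simp
qed

section \<open>Comparison of two spectral decompositions\<close>

lemma spectral_decomposition_basis: "spectral_decomposition A lam v \<Longrightarrow> orthonormal_basis v"
  by (simp add: spectral_decomposition_def)

lemma spectral_decomposition_bilinear_sums:
  assumes "spectral_decomposition A lam v"
  shows "(\<lambda>j. lam j * (v j \<bullet> x) * (v j \<bullet> y)) sums (A x \<bullet> y)"
proof -
  have "(\<lambda>j. lam j *\<^sub>R tensor_op (v j) (v j) x) sums A x"
    using assms by (simp add: spectral_decomposition_def)
  from bounded_linear.sums[OF bounded_linear_inner_left this, of y] show ?thesis
    by (simp add: tensor_op_def mult.assoc)
qed

lemma spectral_decomposition_self_adjoint:
  assumes "spectral_decomposition A lam v"
  shows "self_adjoint A"
  unfolding self_adjoint_def
proof (intro allI)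
  fix x y
  show "A x \<bullet> y = x \<bullet> A y"
    using sums_unique2[OF spectral_decomposition_bilinear_sums[OF assms, of x y]]
      spectral_decomposition_bilinear_sums[OF assms, of y x]
    by (simp add: inner_commute mult_ac)
qed

lemma spectral_decomposition_eigenvector:
  assumes "spectral_decomposition A lam v"
  shows "A x \<bullet> v i = lam i * (v i \<bullet> x)"
proof -
  have o: "v i \<bullet> v j = (if i = j then 1 else 0)" for i j
    using assms by (simp add: spectral_decomposition_def orthonormal_basis_def)
  have "(\<lambda>j. lam j * (v j \<bullet> x) * (v j \<bullet> v i)) sums (\<Sum>j\<in>{i}. lam j * (v j \<bullet> x) * (v j \<bullet> v i))"
    by (rule sums_finite) (auto simp: o)
  then show ?thesis
    using sums_unique2 spectral_decomposition_bilinear_sums[OF assms, of x "v i"] by (force simp: o)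
qed

text \<open>In the mixed pair of eigenbases a difference of operators becomes an entrywise multiple of the
matrix \<open>\<langle>w\<^sub>j, u\<^sub>i\<rangle>\<close>. Everything said below about eigenvalues and truncated inverses rests on this.\<close>

lemma inner_eigenvectors_diff:
  assumes A: "spectral_decomposition A a u" and B: "spectral_decomposition B b w"
  shows "w j \<bullet> (A (u i) - B (u i)) = (a i - b j) * (w j \<bullet> u i)"
proof -
  have "w j \<bullet> A (u i) = A (w j) \<bullet> u i"
    using spectral_decomposition_self_adjoint[OF A] by (simp add: self_adjoint_def)
  then show ?thesis
    using spectral_decomposition_eigenvector[OF A, of "w j" i]
      spectral_decomposition_eigenvector[OF B, of "u i" j]
    by (simp add: inner_diff_right inner_commute algebra_simps)
qed

text \<open>For \<open>i \<in> F\<close> the mass of \<open>u\<^sub>i\<close> outside the span of \<open>w\<^sub>j\<close>, \<open>j \<in> J\<close>, is at most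
\<open>\<parallel>(A - B) u\<^sub>i\<parallel>\<^sup>2 / g\<^sup>2\<close>. The mass inside that span, summed over \<open>i \<in> F\<close>, is at most \<open>card J\<close>
by Bessel's inequality in \<open>u\<close>, while the total mass is \<open>card F\<close>. This takes the place of the min-max
characterization of eigenvalues.\<close>

lemma separated_eigenvalues_card:
  assumes A: "spectral_decomposition A a u" and B: "spectral_decomposition B b w"
    and F: "finite F" and J: "finite J"
    and sep: "\<And>i j. i \<in> F \<Longrightarrow> j \<notin> J \<Longrightarrow> g \<le> \<bar>a i - b j\<bar>" and g: "0 \<le> g"
  shows "g\<^sup>2 * (real (card F) - real (card J)) \<le> (\<Sum>i\<in>F. (norm (A (u i) - B (u i)))\<^sup>2)"
proof -
  note u = orthonormal_basis_orthonormal[OF spectral_decomposition_basis[OF A]]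
  note w = spectral_decomposition_basis[OF B]
  have one: "g\<^sup>2 * (1 - (\<Sum>j\<in>J. (w j \<bullet> u i)\<^sup>2)) \<le> (norm (A (u i) - B (u i)))\<^sup>2" if i: "i \<in> F" for i
  proof -
    have fin: "(\<lambda>j. if j \<in> J then (w j \<bullet> u i)\<^sup>2 else 0) sums (\<Sum>j\<in>J. (w j \<bullet> u i)\<^sup>2)"
      using J by (rule sums_If_finite_set)
    have "(\<lambda>j. g\<^sup>2 * ((w j \<bullet> u i)\<^sup>2 - (if j \<in> J then (w j \<bullet> u i)\<^sup>2 else 0))) sums
        (g\<^sup>2 * (1 - (\<Sum>j\<in>J. (w j \<bullet> u i)\<^sup>2)))"
      using sums_mult[OF sums_diff[OF parseval[OF w, of "u i"] fin], of "g\<^sup>2"] u by simp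
    moreover have "(\<lambda>j. (w j \<bullet> (A (u i) - B (u i)))\<^sup>2) sums (norm (A (u i) - B (u i)))\<^sup>2"
      by (rule parseval[OF w])
    moreover have "g\<^sup>2 * ((w j \<bullet> u i)\<^sup>2 - (if j \<in> J then (w j \<bullet> u i)\<^sup>2 else 0))
        \<le> (w j \<bullet> (A (u i) - B (u i)))\<^sup>2" for j
    proof (cases "j \<in> J")
      case False
      have "g\<^sup>2 \<le> (a i - b j)\<^sup>2"
        using power_mono[OF sep[OF i False] g, of 2] by simp
      then show ?thesis
        using False by (simp add: inner_eigenvectors_diff[OF A B] power_mult_distrib mult_right_mono)
    qed simp
    ultimately show ?thesis by (rule sums_le[rotated])
  qed
  have "(\<Sum>i\<in>F. \<Sum>j\<in>J. (w j \<bullet> u i)\<^sup>2) = (\<Sum>j\<in>J. \<Sum>i\<in>F. (u i \<bullet> w j)\<^sup>2)"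
    by (subst sum.swap) (simp add: inner_commute)
  also have "\<dots> \<le> (\<Sum>j\<in>J. 1)"
    using bessel_inequality[OF u F] orthonormal_basis_orthonormal[OF w]
    by (intro sum_mono) (metis orthonormal_norm one_power2)
  finally have "g\<^sup>2 * (real (card F) - real (card J))
      \<le> g\<^sup>2 * (real (card F) - (\<Sum>i\<in>F. \<Sum>j\<in>J. (w j \<bullet> u i)\<^sup>2))"
    by (intro mult_left_mono) auto
  also have "\<dots> = (\<Sum>i\<in>F. g\<^sup>2 * (1 - (\<Sum>j\<in>J. (w j \<bullet> u i)\<^sup>2)))"
    by (simp add: sum_distrib_left[symmetric] sum_subtractf)
  also have "\<dots> \<le> (\<Sum>i\<in>F. (norm (A (u i) - B (u i)))\<^sup>2)"
    by (intro sum_mono one)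
  finally show ?thesis .
qed

text \<open>Let \<open>G\<close> be the set of indices whose estimated eigenvalue lies above the midpoint of the gap.
Counting with \<open>separated_eigenvalues_card\<close> in both directions gives \<open>card G = d\<close>. Since \<open>C\<close> has no
negative eigenvalues, an estimated eigenvalue cannot be below minus the midpoint either, so the
eigenvalues outside \<open>G\<close> are smaller than those in \<open>G\<close> also in modulus. Each of the two admissible
orders therefore lists \<open>G\<close> first.\<close>

lemma leading_eigenvalues_located:
  assumes C: "spectral_decomposition C lam v" and Ch: "spectral_decomposition Ch lamh vh"
    and lam_order: "decreasing_upto (d + 1) lam" and lam_nonneg: "\<And>j. 0 \<le> lam j"
    and lamh_order: "eigenvalue_order d lamh" and d: "1 \<le> d"
    and diff_v: "\<And>F. finite F \<Longrightarrow> (\<Sum>i\<in>F. (norm (C (v i) - Ch (v i)))\<^sup>2) \<le> \<delta>\<^sup>2"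
    and diff_vh: "\<And>F. finite F \<Longrightarrow> (\<Sum>j\<in>F. (norm (C (vh j) - Ch (vh j)))\<^sup>2) \<le> \<delta>\<^sup>2"
    and \<delta>: "0 \<le> \<delta>" "\<delta> < (lam (d - 1) - lam d) / 2"
  shows "(lam (d - 1) + lam d) / 2 \<le> lamh j \<longleftrightarrow> j < d"
proof -
  define g where "g = (lam (d - 1) - lam d) / 2"
  define mid where "mid = (lam (d - 1) + lam d) / 2"
  define G where "G = {j. mid \<le> lamh j}"
  have g: "0 < g" "\<delta>\<^sup>2 < g\<^sup>2"
    using \<delta> by (auto simp: g_def intro!: power_strict_mono)
  have g_le_mid: "g \<le> mid"
    using lam_nonneg[of d] by (simp add: g_def mid_def)
  have lam_hi: "mid + g \<le> lam i" if "i < d" for i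
    using lam_order that d by (auto simp: decreasing_upto_def mid_def g_def field_simps)
  have lam_lo: "lam i \<le> mid - g" if "d \<le> i" for i
    using lam_order that by (auto simp: decreasing_upto_def mid_def g_def field_simps)
  have gap_card: "m \<le> n" if "g\<^sup>2 * (real m - real n) \<le> \<delta>\<^sup>2" for m n :: nat
  proof (rule ccontr)
    assume "\<not> m \<le> n"
    then have "g\<^sup>2 * 1 \<le> g\<^sup>2 * (real m - real n)" by (intro mult_left_mono) auto
    then show False using that g by linarith
  qed
  have card_le: "card F \<le> d" if F: "finite F" "F \<subseteq> G" for F
  proof -
    have "g\<^sup>2 * (real (card F) - real (card {..<d})) \<le> (\<Sum>j\<in>F. (norm (Ch (vh j) - C (vh j)))\<^sup>2)"
    proof (rule separated_eigenvalues_card[OF Ch C])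
      show "g \<le> \<bar>lamh i - lam j\<bar>" if "i \<in> F" "j \<notin> {..<d}" for i j
        using that lam_lo[of j] F(2) by (force simp: G_def)
    qed (use F g in auto)
    also have "\<dots> \<le> \<delta>\<^sup>2"
      using diff_vh[OF F(1)] by (simp add: norm_minus_commute)
    finally show ?thesis using gap_card by simp
  qed
  then have G: "finite G" "card G \<le> d"
    by (metis infinite_arbitrarily_large not_less_eq_eq order_refl, 
        metis card.infinite order_refl zero_le)
  have "g\<^sup>2 * (real (card {..<d}) - real (card G)) \<le> (\<Sum>i\<in>{..<d}. (norm (C (v i) - Ch (v i)))\<^sup>2)"
  proof (rule separated_eigenvalues_card[OF C Ch])
    show "g \<le> \<bar>lam i - lamh j\<bar>" if "i \<in> {..<d}" "j \<notin> G" for i j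
      using that lam_hi[of i] by (force simp: G_def)
  qed (use G g in auto)
  also have "\<dots> \<le> \<delta>\<^sup>2" by (rule diff_v) simp
  finally have card_G: "card G = d" using gap_card[of d "card G"] G by simp
  \<comment> \<open>A value below \<open>-mid\<close> would have distance at least \<open>g\<close> from every \<open>lam k \<ge> 0\<close>.\<close>
  have lamh_gt: "- mid < lamh j" for j
  proof (rule ccontr)
    assume neg: "\<not> - mid < lamh j"
    have "g\<^sup>2 * (real (card {j}) - real (card ({} :: nat set)))
        \<le> (\<Sum>j\<in>{j}. (norm (Ch (vh j) - C (vh j)))\<^sup>2)"
    proof (rule separated_eigenvalues_card[OF Ch C])
      show "g \<le> \<bar>lamh i - lam k\<bar>" if "i \<in> {j}" for i k
        using that neg lam_nonneg[of k] g_le_mid g by auto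
    qed (use g in auto)
    also have "\<dots> \<le> \<delta>\<^sup>2"
      using diff_vh[of "{j}"] by (simp add: norm_minus_commute)
    finally show False using g by simp
  qed
  obtain f where f: "decreasing_upto d f" "\<And>j. j \<in> G \<Longrightarrow> mid \<le> f j" "\<And>j. j \<notin> G \<Longrightarrow> f j < mid"
  proof (cases "decreasing_upto d lamh")
    case True
    then show ?thesis using that[of lamh] by (auto simp: G_def)
  next
    case False
    then have "decreasing_upto d (\<lambda>j. \<bar>lamh j\<bar>)"
      using lamh_order by (simp add: eigenvalue_order_def)
    moreover have "\<bar>lamh j\<bar> < mid" if "j \<notin> G" for j
      using that lamh_gt[of j] by (auto simp: G_def)
    ultimately show ?thesis using that[of "\<lambda>j. \<bar>lamh j\<bar>"] by (auto simp: G_def)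
  qed
  have "{..<d} \<subseteq> G"
  proof
    fix i assume i: "i \<in> {..<d}"
    show "i \<in> G"
    proof (rule ccontr)
      assume "i \<notin> G"
      then have "\<not> G \<subseteq> {..<d}"
        using card_subset_eq[of "{..<d}" G] card_G i by auto
      then obtain j where "j \<in> G" "d \<le> j" by force
      then have "f j \<le> f i" "mid \<le> f j"
        using f(1,2) i by (auto simp: decreasing_upto_def)
      then show False using f(3)[OF \<open>i \<notin> G\<close>] by simp
    qed
  qed
  then have "G = {..<d}"
    using card_subset_eq[OF G(1) \<open>{..<d} \<subseteq> G\<close>] card_G by simp
  then have "j \<in> G \<longleftrightarrow> j < d" by simp
  then show ?thesis by (simp only: G_def mid_def mem_Collect_eq)
qed

section \<open>Perturbation of the standardized scores\<close>

definition diag_op :: "nat \<Rightarrow> (nat \<Rightarrow> real) \<Rightarrow> (nat \<Rightarrow> 'h::real_inner) \<Rightarrow> 'h \<Rightarrow> 'h" where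
  "diag_op d c u z = (\<Sum>j<d. (c j * (u j \<bullet> z)) *\<^sub>R u j)"

lemma diag_op_symmetric: "diag_op d c u x \<bullet> y = x \<bullet> diag_op d c u y"
  by (simp add: diag_op_def inner_sum_left inner_sum_right inner_commute mult_ac)

lemma inner_diag_op:
  assumes "orthonormal u"
  shows "u i \<bullet> diag_op d c u z = (if i < d then c i else 0) * (u i \<bullet> z)"
proof -
  have "u i \<bullet> diag_op d c u z = (\<Sum>j<d. if i = j then c i * (u i \<bullet> z) else 0)"
    using assms unfolding diag_op_def inner_sum_right
    by (intro sum.cong) (auto simp: orthonormal_def)
  then show ?thesis by simp
qed

lemma diag_op_eigenvector:
  assumes "orthonormal u"
  shows "diag_op d c u (u i) = (if i < d then c i else 0) *\<^sub>R u i"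
proof -
  have "diag_op d c u (u i) = (\<Sum>j<d. if i = j then c i *\<^sub>R u i else 0)"
    using assms unfolding diag_op_def by (intro sum.cong) (auto simp: orthonormal_def)
  then show ?thesis by simp
qed

text \<open>Both differences have entries in the mixed pair of eigenbases that are multiples of \<open>\<langle>vh j, v i\<rangle>\<close>,
so a Lipschitz bound between the eigenvalues passes to the operators. Estimating each
eigenvector separately would instead require all leading eigenvalues to be simple.\<close>

lemma diag_op_diff_norm_le:
  assumes C: "spectral_decomposition C lam v" and Ch: "spectral_decomposition Ch lamh vh"
    and lip: "\<And>i j. \<bar>(if i < d then c i else 0) - (if j < d then ch j else 0)\<bar> \<le> K * \<bar>lam i - lamh j\<bar>"
    and K: "0 \<le> K"
  shows "norm (diag_op d c v (v i) - diag_op d ch vh (v i)) \<le> K * norm (C (v i) - Ch (v i))"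
proof -
  note v = spectral_decomposition_basis[OF C] and vh = spectral_decomposition_basis[OF Ch]
  let ?D = "diag_op d c v (v i) - diag_op d ch vh (v i)"
  have "(vh j \<bullet> ?D)\<^sup>2 \<le> K\<^sup>2 * (vh j \<bullet> (C (v i) - Ch (v i)))\<^sup>2" for j
  proof -
    have "vh j \<bullet> ?D = ((if i < d then c i else 0) - (if j < d then ch j else 0)) * (vh j \<bullet> v i)"
      unfolding inner_diff_right inner_diag_op[OF orthonormal_basis_orthonormal[OF vh]]
        diag_op_eigenvector[OF orthonormal_basis_orthonormal[OF v]]
      by (simp add: algebra_simps)
    then have "\<bar>vh j \<bullet> ?D\<bar> \<le> (K * \<bar>lam i - lamh j\<bar>) * \<bar>vh j \<bullet> v i\<bar>"
      unfolding abs_mult using lip mult_right_mono abs_ge_zero by (simp add: abs_mult mult_right_mono)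
    then have "\<bar>vh j \<bullet> ?D\<bar> \<le> K * \<bar>vh j \<bullet> (C (v i) - Ch (v i))\<bar>"
      unfolding inner_eigenvectors_diff[OF C Ch] abs_mult by (simp add: mult.assoc)
    from power_mono[OF this, of 2] show ?thesis by (simp add: power_mult_distrib)
  qed
  then have "(norm ?D)\<^sup>2 \<le> K\<^sup>2 * (norm (C (v i) - Ch (v i)))\<^sup>2"
    by (rule sums_le[OF _ parseval[OF vh] sums_mult[OF parseval[OF vh]]])
  then have "(norm ?D)\<^sup>2 \<le> (K * norm (C (v i) - Ch (v i)))\<^sup>2"
    by (simp only: power_mult_distrib)
  then show ?thesis by (rule power2_le_imp_le) (simp add: K)
qed

lemma abs_sqrt_diff_le:
  assumes "0 \<le> a" "0 \<le> b"
  shows "\<bar>sqrt a - sqrt b\<bar> \<le> sqrt \<bar>a - b\<bar>"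
proof (rule real_le_rsqrt)
  have "\<bar>sqrt a - sqrt b\<bar> \<le> sqrt a + sqrt b"
    using real_sqrt_ge_zero[OF assms(1)] real_sqrt_ge_zero[OF assms(2)] by (auto simp: abs_le_iff)
  then have "\<bar>sqrt a - sqrt b\<bar> * \<bar>sqrt a - sqrt b\<bar> \<le> \<bar>sqrt a - sqrt b\<bar> * (sqrt a + sqrt b)"
    by (intro mult_left_mono) auto
  also have "\<dots> = \<bar>(sqrt a - sqrt b) * (sqrt a + sqrt b)\<bar>"
    using assms by (simp add: abs_mult)
  also have "(sqrt a - sqrt b) * (sqrt a + sqrt b) = a - b"
    using assms by (simp add: algebra_simps flip: power2_eq_square)
  finally show "\<bar>sqrt a - sqrt b\<bar>\<^sup>2 \<le> \<bar>a - b\<bar>" by (simp add: power2_eq_square)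
qed

lemma L2_set_scores_eq:
  assumes "\<And>j. j < d \<Longrightarrow> 0 < c j"
  shows "L2_set (\<lambda>j. (z \<bullet> u j) / sqrt (c j)) {..<d} = sqrt (z \<bullet> diag_op d (\<lambda>j. 1 / c j) u z)"
proof -
  have "(z \<bullet> u j / sqrt (c j))\<^sup>2 = 1 / c j * (u j \<bullet> z) * (z \<bullet> u j)" if "j < d" for j
    using assms[OF that] by (simp add: power_divide power2_eq_square inner_commute)
  then show ?thesis
    unfolding L2_set_def diag_op_def inner_sum_right by simp
qed

text \<open>With \<open>g\<close> half of the gap, all leading eigenvalues of both operators are at least \<open>mid \<ge> g\<close>, and
a leading eigenvalue of one operator is at distance at least \<open>g\<close> from every non-leading one of the
other. The truncated reciprocal therefore has Lipschitz constant \<open>1 / g\<^sup>2\<close> between the two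
spectra, and the quadratic form of the truncated inverse changes by at most
\<open>(\<delta> / g\<^sup>2) \<parallel>z\<parallel>\<^sup>2\<close>. The scores themselves are square roots of these forms, whence
\<open>sqrt \<delta>\<close>.\<close>

lemma standardized_scores_perturbation:
  assumes C: "spectral_decomposition C lam v" and Ch: "spectral_decomposition Ch lamh vh"
    and lam_order: "decreasing_upto (d + 1) lam" and lam_nonneg: "\<And>j. 0 \<le> lam j"
    and lamh_order: "eigenvalue_order d lamh" and d: "1 \<le> d"
    and diff_v: "\<And>F. finite F \<Longrightarrow> (\<Sum>i\<in>F. (norm (C (v i) - Ch (v i)))\<^sup>2) \<le> \<delta>\<^sup>2"
    and diff_vh: "\<And>F. finite F \<Longrightarrow> (\<Sum>j\<in>F. (norm (C (vh j) - Ch (vh j)))\<^sup>2) \<le> \<delta>\<^sup>2"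
    and \<delta>: "0 \<le> \<delta>" "\<delta> < (lam (d - 1) - lam d) / 2"
  shows "\<And>j. j < d \<Longrightarrow> 0 < lamh j"
    and "\<bar>L2_set (\<lambda>j. (z \<bullet> vh j) / sqrt \<bar>lamh j\<bar>) {..<d} - L2_set (\<lambda>j. (z \<bullet> v j) / sqrt (lam j)) {..<d}\<bar>
      \<le> sqrt \<delta> * (2 / (lam (d - 1) - lam d)) * norm z"
proof -
  define g where "g = (lam (d - 1) - lam d) / 2"
  define mid where "mid = (lam (d - 1) + lam d) / 2"
  have g: "0 < g" using \<delta> by (simp add: g_def)
  have g_le_mid: "g \<le> mid" using lam_nonneg[of d] by (simp add: g_def mid_def)
  have loc: "mid \<le> lamh j \<longleftrightarrow> j < d" for j
    unfolding mid_def
    by (rule leading_eigenvalues_located[OF C Ch lam_order lam_nonneg lamh_order d diff_v diff_vh \<delta>])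
  have lamh_hi: "mid \<le> lamh j" if "j < d" for j using loc that by blast
  have lamh_lo: "lamh j < mid" if "d \<le> j" for j using loc[of j] that by linarith
  show pos: "0 < lamh j" if "j < d" for j
    using lamh_hi[OF that] g g_le_mid by linarith
  have lam_hi: "mid + g \<le> lam i" if "i < d" for i
    using lam_order that d by (auto simp: decreasing_upto_def mid_def g_def field_simps)
  have lam_lo: "lam i \<le> mid - g" if "d \<le> i" for i
    using lam_order that by (auto simp: decreasing_upto_def mid_def g_def field_simps)
  have inv_le: "1 / x \<le> 1 / g" "0 < x" if "mid \<le> x" for x
    using that g g_le_mid by (auto intro!: divide_left_mono mult_pos_pos)
  have inv_gap: "1 / x \<le> (1 / g)\<^sup>2 * y" if "mid \<le> x" "g \<le> y" for x y
  proof -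
    have "1 / g = (1 / g)\<^sup>2 * g" using g by (simp add: power2_eq_square)
    also have "\<dots> \<le> (1 / g)\<^sup>2 * y" using that by (intro mult_left_mono) auto
    finally show ?thesis using inv_le(1)[OF that(1)] by linarith
  qed
  have lip: "\<bar>(if i < d then 1 / lam i else 0) - (if j < d then 1 / lamh j else 0)\<bar>
      \<le> (1 / g)\<^sup>2 * \<bar>lam i - lamh j\<bar>" for i j
  proof (cases "i < d"; cases "j < d")
    assume i: "i < d" and j: "j < d"
    have li: "mid \<le> lam i" and lj: "mid \<le> lamh j"
      using lam_hi[OF i] lamh_hi[OF j] g by auto
    have "\<bar>1 / lam i - 1 / lamh j\<bar> = (1 / lam i) * (1 / lamh j) * \<bar>lam i - lamh j\<bar>"
      using inv_le(2)[OF li] inv_le(2)[OF lj] by (simp add: abs_if field_simps)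
    also have "\<dots> \<le> (1 / g) * (1 / g) * \<bar>lam i - lamh j\<bar>"
      using inv_le[OF li] inv_le[OF lj] g by (intro mult_right_mono mult_mono) auto
    finally show ?thesis using i j by (simp add: power2_eq_square)
  next
    assume i: "i < d" and j: "\<not> j < d"
    have "mid \<le> lam i" "g \<le> \<bar>lam i - lamh j\<bar>"
      using lam_hi[OF i] lamh_lo[of j] j g by auto
    from inv_gap[OF this] inv_le(2)[OF this(1)] show ?thesis using i j by simp
  next
    assume i: "\<not> i < d" and j: "j < d"
    have "mid \<le> lamh j" "g \<le> \<bar>lam i - lamh j\<bar>"
      using lamh_hi[OF j] lam_lo[of i] i g by auto
    from inv_gap[OF this] inv_le(2)[OF this(1)] show ?thesis using i j by simp
  qed simp
  define D where "D x = diag_op d (\<lambda>j. 1 / lam j) v x - diag_op d (\<lambda>j. 1 / lamh j) vh x" for x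
  have D_v: "norm (D (v i)) \<le> (1 / g)\<^sup>2 * norm (C (v i) - Ch (v i))" for i
    unfolding D_def by (rule diag_op_diff_norm_le[OF C Ch lip]) simp
  have "norm (D z) \<le> ((1 / g)\<^sup>2 * \<delta>) * norm z"
  proof (rule self_adjoint_norm_le[OF _ spectral_decomposition_basis[OF C]])
    show "self_adjoint D"
      by (simp add: self_adjoint_def D_def inner_diff_left inner_diff_right diag_op_symmetric)
    show "(\<Sum>j<n. (norm (D (v j)))\<^sup>2) \<le> ((1 / g)\<^sup>2 * \<delta>)\<^sup>2" for n
    proof -
      have "(\<Sum>j<n. (norm (D (v j)))\<^sup>2) \<le> (\<Sum>j<n. ((1 / g)\<^sup>2)\<^sup>2 * (norm (C (v j) - Ch (v j)))\<^sup>2)"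
        using power_mono[OF D_v norm_ge_zero, of _ 2]
        by (intro sum_mono) (simp only: power_mult_distrib)
      also have "\<dots> \<le> ((1 / g)\<^sup>2)\<^sup>2 * \<delta>\<^sup>2"
        unfolding sum_distrib_left[symmetric] by (intro mult_left_mono diff_v) auto
      finally show ?thesis by (simp only: power_mult_distrib)
    qed
  qed (use \<delta> in auto)
  then have "\<bar>z \<bullet> D z\<bar> \<le> norm z * (((1 / g)\<^sup>2 * \<delta>) * norm z)"
    by (meson Cauchy_Schwarz_ineq2 mult_left_mono norm_ge_zero order_trans)
  then have quad: "\<bar>z \<bullet> D z\<bar> \<le> \<delta> * ((1 / g) * norm z)\<^sup>2"
    by (simp add: power2_eq_square mult_ac)
  let ?a = "z \<bullet> diag_op d (\<lambda>j. 1 / lamh j) vh z" and ?b = "z \<bullet> diag_op d (\<lambda>j. 1 / lam j) v z"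
  have lam_pos: "0 < lam j" if "j < d" for j
    using lam_hi[OF that] g g_le_mid by linarith
  have nonneg: "0 \<le> z \<bullet> diag_op d (\<lambda>j. 1 / c j) u z" if "\<And>j. j < d \<Longrightarrow> 0 < c j" for c u
  proof -
    have "z \<bullet> diag_op d (\<lambda>j. 1 / c j) u z = (\<Sum>j<d. (z \<bullet> u j)\<^sup>2 / c j)"
      by (simp add: diag_op_def inner_sum_right inner_commute power2_eq_square)
    also have "\<dots> \<ge> 0"
      using that by (intro sum_nonneg divide_nonneg_pos) auto
    finally show ?thesis .
  qed
  have "L2_set (\<lambda>j. (z \<bullet> vh j) / sqrt \<bar>lamh j\<bar>) {..<d} = L2_set (\<lambda>j. (z \<bullet> vh j) / sqrt (lamh j)) {..<d}"
    using pos by (intro L2_set_cong) (auto simp: less_imp_le)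
  then have "\<bar>L2_set (\<lambda>j. (z \<bullet> vh j) / sqrt \<bar>lamh j\<bar>) {..<d} - L2_set (\<lambda>j. (z \<bullet> v j) / sqrt (lam j)) {..<d}\<bar>
      = \<bar>sqrt ?a - sqrt ?b\<bar>"
    by (simp only: L2_set_scores_eq[of d lamh, OF pos] L2_set_scores_eq[of d lam, OF lam_pos])
  also have "\<dots> \<le> sqrt \<bar>?a - ?b\<bar>"
    by (intro abs_sqrt_diff_le nonneg pos lam_pos)
  also have "\<bar>?a - ?b\<bar> = \<bar>z \<bullet> D z\<bar>"
    by (simp add: D_def inner_diff_right)
  also have "sqrt \<dots> \<le> sqrt (\<delta> * ((1 / g) * norm z)\<^sup>2)"
    using quad by simp
  also have "\<dots> = sqrt \<delta> * (1 / g) * norm z"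
    using g by (simp add: real_sqrt_mult)
  finally show "\<bar>L2_set (\<lambda>j. (z \<bullet> vh j) / sqrt \<bar>lamh j\<bar>) {..<d} - L2_set (\<lambda>j. (z \<bullet> v j) / sqrt (lam j)) {..<d}\<bar>
      \<le> sqrt \<delta> * (2 / (lam (d - 1) - lam d)) * norm z"
    by (simp add: g_def)
qed

section \<open>The long run covariance operator\<close>

lemma strictly_stationary_distr:
  fixes \<epsilon> :: "int \<Rightarrow> 'w \<Rightarrow> 'h::topological_space"
  assumes meas: "\<And>i. \<epsilon> i \<in> borel_measurable M" and stat: "strictly_stationary M \<epsilon>"
  shows "distr M borel (\<epsilon> (j + h)) = distr M borel (\<epsilon> j)"
proof -
  have restr: "(\<lambda>\<omega>. \<lambda>j\<in>{j}. \<epsilon> (j + h) \<omega>) \<in> M \<rightarrow>\<^sub>M (\<Pi>\<^sub>M j\<in>{j}. borel)" for h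
    using meas by (intro measurable_restrict) auto
  have comp: "(\<lambda>f. f j) \<in> (\<Pi>\<^sub>M j\<in>{j}. borel) \<rightarrow>\<^sub>M (borel :: 'h measure)"
    by (rule measurable_component_singleton) simp
  have marginal: "distr (distr M (\<Pi>\<^sub>M j\<in>{j}. borel) (\<lambda>\<omega>. \<lambda>j\<in>{j}. \<epsilon> (j + h) \<omega>)) borel (\<lambda>f. f j)
      = distr M borel (\<epsilon> (j + h))" for h
    by (subst distr_distr[OF comp restr]) (simp add: comp_def)
  have "distr M (\<Pi>\<^sub>M j\<in>{j}. borel) (\<lambda>\<omega>. \<lambda>j\<in>{j}. \<epsilon> (j + h) \<omega>)
      = distr M (\<Pi>\<^sub>M j\<in>{j}. borel) (\<lambda>\<omega>. \<lambda>j\<in>{j}. \<epsilon> (j + 0) \<omega>)"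
    using stat[unfolded strictly_stationary_def] by simp
  then show ?thesis
    using marginal[of h] marginal[of 0] by simp
qed

lemma strictly_stationary_square_integrable:
  fixes \<epsilon> :: "int \<Rightarrow> 'w \<Rightarrow> 'h::{real_normed_vector, second_countable_topology}"
  assumes meas: "\<And>i. \<epsilon> i \<in> borel_measurable M" and stat: "strictly_stationary M \<epsilon>"
    and int: "integrable M (\<lambda>\<omega>. (norm (\<epsilon> j \<omega>))\<^sup>2)"
  shows "integrable M (\<lambda>\<omega>. (norm (\<epsilon> i \<omega>))\<^sup>2)"
proof -
  have "integrable (distr M borel (\<epsilon> j)) (\<lambda>x. (norm x)\<^sup>2)"
    using int meas by (simp add: integrable_distr_eq)
  moreover have "distr M borel (\<epsilon> i) = distr M borel (\<epsilon> j)"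
    using strictly_stationary_distr[OF meas stat, of j "i - j"] by simp
  ultimately show ?thesis
    using integrable_distr_eq[OF meas[of i], of "\<lambda>x. (norm x)\<^sup>2"] by simp
qed

text \<open>The Cauchy-Schwarz inequality for the Bochner integral of a product of a scalar and a vector,
from the quadratic polynomial \<open>t \<mapsto> \<integral>(t |f| - \<parallel>X\<parallel>)\<^sup>2\<close>.\<close>

lemma norm_integral_scaleR_le:
  fixes X :: "'w \<Rightarrow> 'h::{banach, second_countable_topology}" and f :: "'w \<Rightarrow> real"
  assumes [measurable]: "f \<in> borel_measurable M" "X \<in> borel_measurable M"
    and f: "integrable M (\<lambda>\<omega>. (f \<omega>)\<^sup>2)" and X: "integrable M (\<lambda>\<omega>. (norm (X \<omega>))\<^sup>2)"
  shows "(norm (\<integral>\<omega>. f \<omega> *\<^sub>R X \<omega> \<partial>M))\<^sup>2 \<le> (\<integral>\<omega>. (f \<omega>)\<^sup>2 \<partial>M) * (\<integral>\<omega>. (norm (X \<omega>))\<^sup>2 \<partial>M)"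
proof -
  define p q r where "p = (\<integral>\<omega>. (f \<omega>)\<^sup>2 \<partial>M)" and "q = (\<integral>\<omega>. (norm (X \<omega>))\<^sup>2 \<partial>M)"
    and "r = (\<integral>\<omega>. \<bar>f \<omega>\<bar> * norm (X \<omega>) \<partial>M)"
  have prod: "integrable M (\<lambda>\<omega>. \<bar>f \<omega>\<bar> * norm (X \<omega>))"
  proof (rule Bochner_Integration.integrable_bound[OF Bochner_Integration.integrable_add[OF f X]])
    have "\<bar>f \<omega>\<bar> * norm (X \<omega>) \<le> (f \<omega>)\<^sup>2 + (norm (X \<omega>))\<^sup>2" for \<omega>
    proof -
      have "2 * (\<bar>f \<omega>\<bar> * norm (X \<omega>)) \<le> (f \<omega>)\<^sup>2 + (norm (X \<omega>))\<^sup>2"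
        using zero_le_power2[of "\<bar>f \<omega>\<bar> - norm (X \<omega>)"] by (simp add: power2_diff)
      moreover have "0 \<le> \<bar>f \<omega>\<bar> * norm (X \<omega>)" by simp
      ultimately show ?thesis by linarith
    qed
    then show "AE \<omega> in M. norm (\<bar>f \<omega>\<bar> * norm (X \<omega>)) \<le> norm ((f \<omega>)\<^sup>2 + (norm (X \<omega>))\<^sup>2)"
      by simp
  qed simp
  have quad: "0 \<le> t\<^sup>2 * p - 2 * t * r + q" for t
  proof -
    have "0 \<le> (\<integral>\<omega>. (t * \<bar>f \<omega>\<bar> - norm (X \<omega>))\<^sup>2 \<partial>M)" by simp
    also have "\<dots> = (\<integral>\<omega>. t\<^sup>2 * (f \<omega>)\<^sup>2 - 2 * t * (\<bar>f \<omega>\<bar> * norm (X \<omega>)) + (norm (X \<omega>))\<^sup>2 \<partial>M)"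
      by (intro Bochner_Integration.integral_cong) (auto simp: power2_diff power_mult_distrib)
    also have "\<dots> = t\<^sup>2 * p - 2 * t * r + q"
      using f X prod by (simp add: p_def q_def r_def)
    finally show ?thesis .
  qed
  have "0 \<le> p" "0 \<le> q" "0 \<le> r" by (simp_all add: p_def q_def r_def)
  have "r\<^sup>2 \<le> p * q"
  proof (cases "p = 0")
    case True
    \<comment> \<open>The polynomial is then affine in \<open>t\<close>, and negative for large \<open>t\<close> unless its slope is 0.\<close>
    have "r = 0"
    proof (rule ccontr)
      assume "r \<noteq> 0"
      then show False
        using quad[of "(q + 1) / (2 * r)"] True by simp
    qed
    then show ?thesis using True by simp
  next
    case False
    then have "0 \<le> p * ((r / p)\<^sup>2 * p - 2 * (r / p) * r + q)"
      by (intro mult_nonneg_nonneg quad \<open>0 \<le> p\<close>)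
    also have "\<dots> = p * q - r\<^sup>2"
      using False by (simp add: power2_eq_square field_simps)
    finally show ?thesis by simp
  qed
  moreover have "norm (\<integral>\<omega>. f \<omega> *\<^sub>R X \<omega> \<partial>M) \<le> r"
    using integral_norm_bound[of M "\<lambda>\<omega>. f \<omega> *\<^sub>R X \<omega>"] by (simp add: r_def)
  ultimately show ?thesis
    unfolding p_def[symmetric] q_def[symmetric]
    by (meson norm_ge_zero order_trans power_mono)
qed

text \<open>By Cauchy-Schwarz the term with index \<open>j\<close> is at most
\<open>E \<langle>\<epsilon>\<^sub>h, e\<^sub>j\<rangle>\<^sup>2 \<cdot> E \<parallel>\<epsilon>\<^sub>0\<parallel>\<^sup>2\<close>, and Bessel's inequality bounds the sum over \<open>j\<close>.\<close>

lemma autocov_op_hilbert_schmidt_sum: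
  fixes \<epsilon> :: "int \<Rightarrow> 'w \<Rightarrow> 'h::{real_inner, banach, second_countable_topology}"
  assumes meas [measurable]: "\<And>i. \<epsilon> i \<in> borel_measurable M"
    and int: "\<And>i. integrable M (\<lambda>\<omega>. (norm (\<epsilon> i \<omega>))\<^sup>2)"
    and e: "orthonormal e"
  shows "summable (\<lambda>j. (norm (autocov_op M \<epsilon> h (e j)))\<^sup>2)"
proof (rule summableI_nonneg_bounded)
  let ?q = "\<integral>\<omega>. (norm (\<epsilon> 0 \<omega>))\<^sup>2 \<partial>M"
  fix n
  have score_int: "integrable M (\<lambda>\<omega>. (\<epsilon> h \<omega> \<bullet> e j)\<^sup>2)" for j
  proof (rule Bochner_Integration.integrable_bound[OF int[of h]])
    show "AE \<omega> in M. norm ((\<epsilon> h \<omega> \<bullet> e j)\<^sup>2) \<le> norm ((norm (\<epsilon> h \<omega>))\<^sup>2)"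
      using bessel_inequality[OF e, of "{j}"] by (simp add: inner_commute[of _ "e j"])
  qed simp
  have "(\<Sum>j<n. (norm (autocov_op M \<epsilon> h (e j)))\<^sup>2) \<le> (\<Sum>j<n. (\<integral>\<omega>. (\<epsilon> h \<omega> \<bullet> e j)\<^sup>2 \<partial>M) * ?q)"
    unfolding autocov_op_def tensor_op_def
    by (intro sum_mono norm_integral_scaleR_le score_int int) simp_all
  also have "\<dots> = (\<integral>\<omega>. (\<Sum>j<n. (\<epsilon> h \<omega> \<bullet> e j)\<^sup>2) \<partial>M) * ?q"
    using score_int by (simp add: sum_distrib_right Bochner_Integration.integral_sum)
  also have "\<dots> \<le> (\<integral>\<omega>. (norm (\<epsilon> h \<omega>))\<^sup>2 \<partial>M) * ?q"
    using bessel_inequality[OF e, of "{..<n}"] score_int int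
    by (intro mult_right_mono integral_mono) (auto simp: inner_commute[of _ "e _"])
  finally show "(\<Sum>j<n. (norm (autocov_op M \<epsilon> h (e j)))\<^sup>2)
      \<le> (\<integral>\<omega>. (norm (\<epsilon> h \<omega>))\<^sup>2 \<partial>M) * ?q" .
qed simp

lemma L2_set_norm_sum_le:
  assumes "finite F"
  shows "L2_set (\<lambda>j. norm (\<Sum>h\<in>F. f h j)) J \<le> (\<Sum>h\<in>F. L2_set (\<lambda>j. norm (f h j)) J)"
  using assms
proof (induction F rule: finite_induct)
  case empty
  then show ?case by (simp add: L2_set_def)
next
  case (insert h F)
  have "L2_set (\<lambda>j. norm (\<Sum>h\<in>insert h F. f h j)) J
      \<le> L2_set (\<lambda>j. norm (f h j) + norm (\<Sum>h\<in>F. f h j)) J"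
    using insert(1,2) by (intro L2_set_mono) (auto simp: norm_triangle_ineq)
  also have "\<dots> \<le> L2_set (\<lambda>j. norm (f h j)) J + L2_set (\<lambda>j. norm (\<Sum>h\<in>F. f h j)) J"
    by (rule L2_set_triangle_ineq)
  finally show ?case using insert by simp
qed

text \<open>Minkowski's inequality for a series of operators. The values are summed pointwise, so the bound is
proved for finite sums over finitely many basis vectors and then passed to the limit.\<close>

lemma infsum_hilbert_schmidt_sum:
  fixes A :: "'i \<Rightarrow> 'h::{real_inner, banach} \<Rightarrow> 'h"
  assumes A: "\<And>h. summable (\<lambda>j. (norm (A h (hs_basis j)))\<^sup>2)"
    and S: "(\<lambda>h. hs_norm (A h)) summable_on UNIV"
  shows "summable (\<lambda>j. (norm (\<Sum>\<^sub>\<infinity>h. A h (hs_basis j)))\<^sup>2)"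
proof (rule summableI_nonneg_bounded)
  let ?S = "\<Sum>\<^sub>\<infinity>h. hs_norm (A h)"
  fix n
  have partial: "L2_set (\<lambda>j. norm (A h (hs_basis j))) {..<n} \<le> hs_norm (A h)" for h n
    unfolding L2_set_def hs_norm_eq using A by (intro real_sqrt_le_mono sum_le_suminf) auto
  then have nonneg: "0 \<le> hs_norm (A h)" for h
    using L2_set_nonneg order_trans by blast
  have entry: "norm (A h (hs_basis j)) \<le> hs_norm (A h)" for h j
    using member_le_L2_set[of "{..<Suc j}" j "\<lambda>j. norm (A h (hs_basis j))"]
      partial[of h "Suc j"] by simp
  have "(\<lambda>h. norm (A h (hs_basis j))) summable_on UNIV" for j
    by (rule summable_on_comparison_test[OF S]) (use entry in auto)
  then have "(\<lambda>h. A h (hs_basis j)) summable_on UNIV" for j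
    by (rule abs_summable_summable)
  then have lim: "(sum (\<lambda>h. A h (hs_basis j)) \<longlongrightarrow> (\<Sum>\<^sub>\<infinity>h. A h (hs_basis j)))
      (finite_subsets_at_top UNIV)" for j
    by (rule infsum_tendsto)
  have "((\<lambda>F. L2_set (\<lambda>j. norm (\<Sum>h\<in>F. A h (hs_basis j))) {..<n})
      \<longlongrightarrow> L2_set (\<lambda>j. norm (\<Sum>\<^sub>\<infinity>h. A h (hs_basis j))) {..<n}) (finite_subsets_at_top UNIV)"
    unfolding L2_set_def by (intro tendsto_intros lim)
  moreover have "\<forall>\<^sub>F F in finite_subsets_at_top UNIV.
      L2_set (\<lambda>j. norm (\<Sum>h\<in>F. A h (hs_basis j))) {..<n} \<le> ?S"
  proof (rule eventually_finite_subsets_at_top_weakI)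
    fix F :: "'i set" assume F: "finite F"
    have "L2_set (\<lambda>j. norm (\<Sum>h\<in>F. A h (hs_basis j))) {..<n}
        \<le> (\<Sum>h\<in>F. L2_set (\<lambda>j. norm (A h (hs_basis j))) {..<n})"
      by (rule L2_set_norm_sum_le[OF F])
    also have "\<dots> \<le> (\<Sum>h\<in>F. hs_norm (A h))"
      by (intro sum_mono partial)
    also have "\<dots> \<le> ?S"
      using F S nonneg by (intro finite_sum_le_infsum) auto
    finally show "L2_set (\<lambda>j. norm (\<Sum>h\<in>F. A h (hs_basis j))) {..<n} \<le> ?S" .
  qed
  ultimately have "L2_set (\<lambda>j. norm (\<Sum>\<^sub>\<infinity>h. A h (hs_basis j))) {..<n} \<le> ?S"
    by (rule tendsto_upperbound) simp
  then have "(L2_set (\<lambda>j. norm (\<Sum>\<^sub>\<infinity>h. A h (hs_basis j))) {..<n})\<^sup>2 \<le> ?S\<^sup>2"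
    by (intro power_mono L2_set_nonneg)
  then show "(\<Sum>j<n. (norm (\<Sum>\<^sub>\<infinity>h. A h (hs_basis j)))\<^sup>2) \<le> ?S\<^sup>2"
    by (simp add: L2_set_def sum_nonneg)
qed simp

text \<open>The norms of the autocovariance operators bound the sum over the one basis in which
\<^const>\<open>hs_norm\<close> is computed; self-adjointness carries the bound over to every other basis.\<close>

lemma long_run_cov_op_hilbert_schmidt:
  fixes \<epsilon> :: "int \<Rightarrow> 'w \<Rightarrow> 'h::{real_inner, banach, second_countable_topology}"
  assumes \<epsilon>: "\<And>i. \<epsilon> i \<in> borel_measurable M" "\<And>i. integrable M (\<lambda>\<omega>. (norm (\<epsilon> i \<omega>))\<^sup>2)"
    and summable: "(\<lambda>h. hs_norm (autocov_op M \<epsilon> h)) summable_on UNIV"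
    and adj: "self_adjoint (long_run_cov_op M \<epsilon>)"
    and e: "orthonormal_basis e"
  shows "summable (\<lambda>j. (norm (long_run_cov_op M \<epsilon> (e j)))\<^sup>2)"
proof -
  have b: "orthonormal_basis (hs_basis :: nat \<Rightarrow> 'h)"
    using e by (rule orthonormal_basis_hs_basis)
  have "summable (\<lambda>j. (norm (autocov_op M \<epsilon> h (hs_basis j)))\<^sup>2)" for h
    using \<epsilon> b by (intro autocov_op_hilbert_schmidt_sum orthonormal_basis_orthonormal)
  then have S: "summable (\<lambda>j. (norm (long_run_cov_op M \<epsilon> (hs_basis j)))\<^sup>2)"
    unfolding long_run_cov_op_def using summable by (rule infsum_hilbert_schmidt_sum)
  show ?thesis
    by (rule summableI_nonneg_bounded)
      (use sum_norm_image_le[OF adj b orthonormal_basis_orthonormal[OF e] S] in auto)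
qed

section \<open>Convergence in distribution\<close>

text \<open>Slutsky's lemma. As \<open>F\<close> is monotone, it has continuity points \<open>a < t < b\<close> arbitrarily close to
\<open>t\<close>. Where the variables are closer than both \<open>t - a\<close> and \<open>b - t\<close>, the event \<open>That \<le> t\<close> lies
between \<open>T \<le> a\<close> and \<open>T \<le> b\<close>. The exceptional events are measurable, so that \<^const>\<open>measure\<close>
really bounds them.\<close>

lemma weak_conv_perturbation:
  fixes T :: "nat \<Rightarrow> 'w \<Rightarrow> real" and That :: "nat \<Rightarrow> 'w \<Rightarrow> ereal"
  assumes M: "prob_space M"
    and T: "\<forall>\<^sub>F n in sequentially. T n \<in> borel_measurable M"
    and That: "\<forall>\<^sub>F n in sequentially. That n \<in> borel_measurable M"
    and F: "mono F"
    and conv: "weak_conv (\<lambda>n t. measure M {\<omega> \<in> space M. T n \<omega> \<le> t}) F"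
    and close: "\<And>s p. 0 < s \<Longrightarrow> 0 < p \<Longrightarrow> \<forall>\<^sub>F n in sequentially. \<exists>E\<in>sets M. measure M E < p \<and>
        (\<forall>\<omega>\<in>space M - E. ereal (T n \<omega> - s) \<le> That n \<omega> \<and> That n \<omega> \<le> ereal (T n \<omega> + s))"
  shows "weak_conv (\<lambda>n t. measure M {\<omega> \<in> space M. That n \<omega> \<le> ereal t}) F"
  unfolding weak_conv_def
proof (intro allI impI LIMSEQ_I)
  interpret prob_space M by (rule M)
  fix t r :: real assume t: "isCont F t" and r: "0 < r"
  then obtain \<eta> where \<eta>: "0 < \<eta>" "\<And>x. dist x t < \<eta> \<Longrightarrow> dist (F x) (F t) < r / 3"
    unfolding continuous_at_eps_delta by (metis divide_pos_pos zero_less_numeral)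
  have dense: "\<exists>s\<in>{a<..<b}. isCont F s" if "a < b" for a b :: real
    using uncountable_open_interval[of a b] countable_subset[OF _ mono_ctble_discont[OF F]] that
    by blast
  obtain a where a: "t - \<eta> < a" "a < t" "isCont F a"
    using dense[of "t - \<eta>" t] \<eta>(1) by auto
  obtain b where b: "t < b" "b < t + \<eta>" "isCont F b"
    using dense[of t "t + \<eta>"] \<eta>(1) by auto
  have Fab: "F t - r / 3 < F a" "F b < F t + r / 3"
    using \<eta>(2)[of a, unfolded dist_real_def] \<eta>(2)[of b, unfolded dist_real_def] a b
    by linarith+
  have lim: "\<forall>\<^sub>F n in sequentially. \<bar>measure M {\<omega> \<in> space M. T n \<omega> \<le> x} - F x\<bar> < r / 3" if "isCont F x" for x
    using tendstoD[OF conv[unfolded weak_conv_def, rule_format, OF that], of "r / 3"] r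
    by (simp only: dist_real_def)
  have s: "0 < min (t - a) (b - t)" and r3: "0 < r / 3"
    using a b r by auto
  have "\<forall>\<^sub>F n in sequentially. norm (measure M {\<omega> \<in> space M. That n \<omega> \<le> ereal t} - F t) < r"
    using lim[OF a(3)] lim[OF b(3)] close[OF s r3] T That
  proof eventually_elim
    case (elim n)
    from elim(3) obtain E where E: "E \<in> sets M" "measure M E < r / 3"
      "\<And>\<omega>. \<omega> \<in> space M - E \<Longrightarrow> ereal (T n \<omega> - min (t - a) (b - t)) \<le> That n \<omega>"
      "\<And>\<omega>. \<omega> \<in> space M - E \<Longrightarrow> That n \<omega> \<le> ereal (T n \<omega> + min (t - a) (b - t))"
      by auto
    note [measurable] = elim(4,5) E(1)
    let ?H = "{\<omega> \<in> space M. That n \<omega> \<le> ereal t}"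
    have "?H \<subseteq> {\<omega> \<in> space M. T n \<omega> \<le> b} \<union> E"
    proof
      fix \<omega> assume \<omega>: "\<omega> \<in> ?H"
      have "T n \<omega> \<le> b" if "\<omega> \<notin> E"
      proof -
        have "ereal (T n \<omega> - min (t - a) (b - t)) \<le> ereal t"
          using E(3)[of \<omega>] \<omega> that order_trans by blast
        then show ?thesis by (simp add: min_def split: if_splits)
      qed
      then show "\<omega> \<in> {\<omega> \<in> space M. T n \<omega> \<le> b} \<union> E" using \<omega> by auto
    qed
    then have "measure M ?H \<le> measure M ({\<omega> \<in> space M. T n \<omega> \<le> b} \<union> E)"
      by (intro finite_measure_mono) measurable
    also have "\<dots> \<le> measure M {\<omega> \<in> space M. T n \<omega> \<le> b} + measure M E"
      by (intro measure_Un_le) measurable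
    finally have upper: "measure M ?H \<le> measure M {\<omega> \<in> space M. T n \<omega> \<le> b} + measure M E" .
    have "{\<omega> \<in> space M. T n \<omega> \<le> a} \<subseteq> ?H \<union> E"
    proof
      fix \<omega> assume \<omega>: "\<omega> \<in> {\<omega> \<in> space M. T n \<omega> \<le> a}"
      have "That n \<omega> \<le> ereal t" if "\<omega> \<notin> E"
      proof -
        have "That n \<omega> \<le> ereal (T n \<omega> + min (t - a) (b - t))"
          using E(4)[of \<omega>] \<omega> that by blast
        also have "\<dots> \<le> ereal t" using \<omega> by (simp add: min_def)
        finally show ?thesis .
      qed
      then show "\<omega> \<in> ?H \<union> E" using \<omega> by auto
    qed
    then have "measure M {\<omega> \<in> space M. T n \<omega> \<le> a} \<le> measure M (?H \<union> E)"
      by (intro finite_measure_mono) measurable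
    also have "\<dots> \<le> measure M ?H + measure M E"
      by (intro measure_Un_le) measurable
    finally show ?case
      using upper elim(1,2) E(2) Fab unfolding real_norm_def by linarith
  qed
  then show "\<exists>n0. \<forall>n\<ge>n0. norm (measure M {\<omega> \<in> space M. That n \<omega> \<le> ereal t} - F t) < r"
    by (simp add: eventually_sequentially)
qed

text \<open>The paths are continuous, so the supremum may be taken over the rationals of \<open>(0,1)\<close>.\<close>

lemma bridge_sup_measurable:
  assumes "independent_brownian_bridges N d B"
  shows "bridge_sup d B \<in> borel_measurable N"
proof -
  have bb: "brownian_bridge N (B r)" if "r < d" for r
    using assms that by (simp add: independent_brownian_bridges_def)
  have meas: "B r x \<in> borel_measurable N" if "r < d" "x \<in> {0..1}" for r x
  proof -
    have "normal_variable N (\<lambda>\<omega>. \<Sum>t\<in>{x}. 1 * B r t \<omega>)"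
      using bb[OF that(1)] that(2) unfolding brownian_bridge_def gaussian_process_def
      by (elim conjE allE[of _ "{x}"] allE[of _ "\<lambda>_. 1"]) auto
    then show ?thesis by (simp add: normal_variable_def)
  qed
  define f where "f \<omega> x = sqrt (\<Sum>r<d. (B r x \<omega>)\<^sup>2)" for \<omega> x
  have cont: "continuous_on {0..1} (f \<omega>)" if "\<omega> \<in> space N" for \<omega>
    unfolding f_def using bb that by (intro continuous_intros) (auto simp: brownian_bridge_def)
  define Q where "Q = {0<..<1} \<inter> (\<rat> :: real set)"
  have Q: "closure Q = {0..1}"
    unfolding Q_def by (subst closure_open_Int_superset) (auto simp: Rats_closure_real)
  have "bridge_sup d B \<omega> \<le> a \<longleftrightarrow> (\<forall>x\<in>Q. f \<omega> x \<le> a)" if \<omega>: "\<omega> \<in> space N" for \<omega> a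
  proof -
    have "bridge_sup d B \<omega> \<le> a \<longleftrightarrow> (\<forall>x\<in>{0..1}. f \<omega> x \<le> a)"
      unfolding bridge_sup_def f_def[symmetric]
    proof (rule cSUP_le_iff)
      show "bdd_above (f \<omega> ` {0..1})"
        by (rule bounded_imp_bdd_above[OF compact_imp_bounded
              [OF compact_continuous_image[OF cont[OF \<omega>] compact_Icc]]])
    qed simp
    also have "\<dots> \<longleftrightarrow> (\<forall>x\<in>Q. f \<omega> x \<le> a)"
    proof
      assume "\<forall>x\<in>Q. f \<omega> x \<le> a"
      then show "\<forall>x\<in>{0..1}. f \<omega> x \<le> a"
        using continuous_le_on_closure[of Q "f \<omega>" _ a] cont[OF \<omega>] unfolding Q by blast
    qed (auto simp: Q_def)
    finally show ?thesis .
  qed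
  then have eq: "{\<omega> \<in> space N. bridge_sup d B \<omega> \<le> a} = {\<omega> \<in> space N. \<forall>x\<in>Q. f \<omega> x \<le> a}" for a
    by auto
  have [measurable]: "(\<lambda>\<omega>. f \<omega> x) \<in> borel_measurable N" if "x \<in> Q" for x
  proof -
    have "(\<lambda>\<omega>. \<Sum>r<d. (B r x \<omega>)\<^sup>2) \<in> borel_measurable N"
      using that meas by (intro borel_measurable_sum borel_measurable_power) (auto simp: Q_def)
    then show ?thesis unfolding f_def by measurable
  qed
  have "countable Q" by (simp add: Q_def countable_rat)
  then show ?thesis
    unfolding borel_measurable_iff_le eq by (intro allI sets.sets_Collect_countable_Ball) measurable
qed

section \<open>The statistics\<close>

lemma cusum_add_const:
  assumes "k \<le> n" "\<And>i. 1 \<le> i \<Longrightarrow> i \<le> n \<Longrightarrow> x i = c + y i"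
  shows "cusum n k x = cusum n k y"
proof (cases "n = 0")
  case False
  have "(\<Sum>l=1..n. x l) = (\<Sum>l=1..n. c + y l)"
    using assms(2) by (intro sum.cong) auto
  then have "(\<Sum>l=1..n. x l) = real n *\<^sub>R c + (\<Sum>l=1..n. y l)"
    by (simp add: sum.distrib sum_constant_scaleR)
  then have "(1 / real n) *\<^sub>R (\<Sum>l=1..n. x l) = c + (1 / real n) *\<^sub>R (\<Sum>l=1..n. y l)"
    using False by (simp add: scaleR_add_right)
  then show ?thesis
    using assms unfolding cusum_def by (auto intro!: sum.cong)
qed (simp add: cusum_def)

lemma cusum_inner: "cusum n k (\<lambda>i. x i \<bullet> u) = cusum n k x \<bullet> u"
  by (simp add: cusum_def inner_sum_left inner_diff_left sum_subtractf)

lemma proj_statistic_eq: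
  "proj_statistic d lam v n x =
    Max ((\<lambda>k. L2_set (\<lambda>j. (cusum n k x \<bullet> v j) / sqrt (lam j)) {..<d}) ` {1..<n})"
  by (simp add: proj_statistic_def cusum_inner)

lemma abs_Max_diff_le:
  fixes f g :: "'a \<Rightarrow> real"
  assumes "finite K" "K \<noteq> {}" "\<And>k. k \<in> K \<Longrightarrow> \<bar>f k - g k\<bar> \<le> s"
  shows "\<bar>Max (f ` K) - Max (g ` K)\<bar> \<le> s"
proof -
  have "Max (p ` K) \<le> Max (q ` K) + s" if "\<And>k. k \<in> K \<Longrightarrow> \<bar>p k - q k\<bar> \<le> s" for p q :: "'a \<Rightarrow> real"
  proof -
    have "p k \<le> Max (q ` K) + s" if k: "k \<in> K" for k
    proof -
      have "q k \<le> Max (q ` K)" using assms(1) k by (intro Max_ge) auto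
      then show ?thesis using \<open>\<And>k. k \<in> K \<Longrightarrow> \<bar>p k - q k\<bar> \<le> s\<close>[OF k] by linarith
    qed
    then show ?thesis using assms(1,2) by (subst Max_le_iff) auto
  qed
  from this[of f g] this[of g f] assms(3) show ?thesis
    by (simp add: abs_minus_commute abs_le_iff)
qed

text \<open>The measurability of \<open>A\<close> concerns its values at fixed vectors, whereas the eigenvector is random.
Expanding the eigenvector \<open>u \<omega>\<close> in a fixed basis, and moving \<open>A \<omega>\<close> onto the fixed basis vectors, expresses
the eigenvalue \<open>\<langle>A u, u\<rangle>\<close> through these values.\<close>

lemma eigenvalue_measurable:
  fixes u :: "'w \<Rightarrow> 'h::{real_inner, second_countable_topology}"
  assumes A [measurable]: "\<And>x. (\<lambda>\<omega>. A \<omega> x) \<in> borel_measurable M"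
    and adj: "\<And>\<omega>. \<omega> \<in> space M \<Longrightarrow> self_adjoint (A \<omega>)"
    and [measurable]: "u \<in> borel_measurable M"
    and eig: "\<And>\<omega>. \<omega> \<in> space M \<Longrightarrow> A \<omega> (u \<omega>) \<bullet> u \<omega> = c \<omega>"
    and e: "orthonormal_basis (e :: nat \<Rightarrow> 'h)"
  shows "c \<in> borel_measurable M"
proof -
  have "c \<omega> = (\<Sum>j. (e j \<bullet> u \<omega>) * (A \<omega> (e j) \<bullet> u \<omega>))" if \<omega>: "\<omega> \<in> space M" for \<omega>
  proof -
    have "(\<lambda>j. ((e j \<bullet> u \<omega>) *\<^sub>R e j) \<bullet> A \<omega> (u \<omega>)) sums (u \<omega> \<bullet> A \<omega> (u \<omega>))"
      by (intro bounded_linear.sums[OF bounded_linear_inner_left] orthonormal_basis_expansion e)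
    moreover have "e j \<bullet> A \<omega> (u \<omega>) = A \<omega> (e j) \<bullet> u \<omega>" for j
      using adj[OF \<omega>] by (simp add: self_adjoint_def)
    ultimately show ?thesis
      using eig[OF \<omega>] by (simp add: inner_commute[of "u \<omega>"] sums_iff)
  qed
  then show ?thesis
    by (subst measurable_cong[of _ _ "\<lambda>\<omega>. \<Sum>j. (e j \<bullet> u \<omega>) * (A \<omega> (e j) \<bullet> u \<omega>)"]) auto
qed

lemma cusum_measurable [measurable]:
  fixes x :: "nat \<Rightarrow> 'w \<Rightarrow> 'h::{real_normed_vector, second_countable_topology}"
  assumes [measurable]: "\<And>i. x i \<in> borel_measurable M"
  shows "(\<lambda>\<omega>. cusum n k (\<lambda>i. x i \<omega>)) \<in> borel_measurable M"
  unfolding cusum_def by measurable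

lemma proj_statistic_measurable:
  fixes x :: "nat \<Rightarrow> 'w \<Rightarrow> 'h::{real_inner, second_countable_topology}"
  assumes [measurable]: "\<And>i. x i \<in> borel_measurable M"
    and lam: "\<And>j. j < d \<Longrightarrow> (\<lambda>\<omega>. lam \<omega> j) \<in> borel_measurable M"
    and v: "\<And>j. j < d \<Longrightarrow> (\<lambda>\<omega>. v \<omega> j) \<in> borel_measurable M"
    and n: "2 \<le> n"
  shows "(\<lambda>\<omega>. proj_statistic d (lam \<omega>) (v \<omega>) n (\<lambda>i. x i \<omega>)) \<in> borel_measurable M"
  unfolding proj_statistic_eq L2_set_def
proof (rule borel_measurable_Max)
  fix k
  have "(\<lambda>\<omega>. (cusum n k (\<lambda>i. x i \<omega>) \<bullet> v \<omega> j / sqrt (lam \<omega> j))\<^sup>2) \<in> borel_measurable M" if "j < d" for j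
    using lam[OF that] v[OF that] by measurable
  then have "(\<lambda>\<omega>. \<Sum>j<d. (cusum n k (\<lambda>i. x i \<omega>) \<bullet> v \<omega> j / sqrt (lam \<omega> j))\<^sup>2) \<in> borel_measurable M"
    by (intro borel_measurable_sum) auto
  then show "(\<lambda>\<omega>. sqrt (\<Sum>j<d. (cusum n k (\<lambda>i. x i \<omega>) \<bullet> v \<omega> j / sqrt (lam \<omega> j))\<^sup>2)) \<in> borel_measurable M"
    by measurable
qed (use n in auto)

lemma hs_norm_diff_measurable:
  fixes C :: "'h::{real_inner, second_countable_topology} \<Rightarrow> 'h"
  assumes [measurable]: "\<And>x. (\<lambda>\<omega>. A \<omega> x) \<in> borel_measurable M"
  shows "(\<lambda>\<omega>. hs_norm (\<lambda>x. C x - A \<omega> x)) \<in> borel_measurable M"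
  unfolding hs_norm_eq by measurable

theorem theorem4p3:
  fixes M :: "'w measure"
    and N :: "'b measure"
    and \<epsilon> :: "int \<Rightarrow> 'w \<Rightarrow> 'h::{real_inner, banach, second_countable_topology}"
    and g :: "real \<Rightarrow> real" and \<Delta> :: 'h
    and Chat :: "nat \<Rightarrow> 'w \<Rightarrow> 'h \<Rightarrow> 'h"
    and lam :: "nat \<Rightarrow> real" and v :: "nat \<Rightarrow> 'h"
    and lamh :: "nat \<Rightarrow> 'w \<Rightarrow> nat \<Rightarrow> real" and vh :: "nat \<Rightarrow> 'w \<Rightarrow> nat \<Rightarrow> 'h"
    and B :: "nat \<Rightarrow> real \<Rightarrow> 'b \<Rightarrow> real"
    and d :: nat
  defines "C \<equiv> long_run_cov_op M \<epsilon>"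
    and "\<eta> \<equiv> observation g \<Delta> \<epsilon>"
    and "H0 \<equiv> g constant_on {0..1}"
  assumes infinite_dim: "\<nexists>F :: 'h set. finite F \<and> span F = UNIV"
    and M: "prob_space M"
    and \<Delta>: "norm \<Delta> = 1"
    and g: "piecewise_lipschitz g"
    and \<epsilon>_measurable: "\<And>i. \<epsilon> i \<in> borel_measurable M"
    and \<epsilon>_stationary: "strictly_stationary M \<epsilon>"
    and \<epsilon>_square_integrable: "integrable M (\<lambda>\<omega>. (norm (\<epsilon> 1 \<omega>))\<^sup>2)"
    and \<epsilon>_centered: "\<And>i. (\<integral>\<omega>. \<epsilon> i \<omega> \<partial>M) = 0"
    and autocov_summable: "(\<lambda>h. hs_norm (autocov_op M \<epsilon> h)) summable_on UNIV"
    and d: "1 \<le> d"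
    and C_spectral: "spectral_decomposition C lam v"
    and lam_order: "decreasing_upto (d + 1) lam"
    and lam_nonneg: "\<And>j. 0 \<le> lam j"
    and lam_d_pos: "0 < lam (d - 1)"
    and Chat_measurable: "\<And>n x. (\<lambda>\<omega>. Chat n \<omega> x) \<in> borel_measurable M"
    and Chat_HS: "\<And>n \<omega>. \<omega> \<in> space M \<Longrightarrow> hilbert_schmidt (Chat n \<omega>)"
    and Chat_self_adjoint: "\<And>n \<omega>. \<omega> \<in> space M \<Longrightarrow> self_adjoint (Chat n \<omega>)"
    and Chat_spectral:
      "\<And>n \<omega>. \<omega> \<in> space M \<Longrightarrow> spectral_decomposition (Chat n \<omega>) (lamh n \<omega>) (vh n \<omega>)"
    and lamh_order: "\<And>n \<omega>. \<omega> \<in> space M \<Longrightarrow> eigenvalue_order d (lamh n \<omega>)"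
    and vh_measurable: "\<And>n j. j < d \<Longrightarrow> (\<lambda>\<omega>. vh n \<omega> j) \<in> borel_measurable M"
    and N: "prob_space N"
    and bridges: "independent_brownian_bridges N d B"
    and i: "little_oP_1 M (\<lambda>n \<omega>. hs_norm (\<lambda>x. C x - Chat n \<omega> x))"
    and ii: "lam (d - 1) > lam d"
    and iii: "H0 \<Longrightarrow> weak_conv_m
        (\<lambda>n. distr M borel (\<lambda>\<omega>. proj_statistic d lam v n (\<lambda>i. \<eta> n i \<omega>)))
        (distr N borel (bridge_sup d B))"
    and iv: "big_OP_1 M
        (\<lambda>n \<omega>. Max ((\<lambda>k. norm (cusum n k (\<lambda>i. \<epsilon> (int i) \<omega>))) ` {1..<n}))"
  shows "H0 \<Longrightarrow> conv_in_distribution M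
      (\<lambda>n \<omega>. proj_statistic_hat d (lamh n \<omega>) (vh n \<omega>) n (\<lambda>i. \<eta> n i \<omega>))
      N (bridge_sup d B)"
proof -
  interpret prob_space M by (rule M)
  note [measurable] = \<epsilon>_measurable
  assume H0: H0
  define S where "S n k \<omega> = cusum n k (\<lambda>i. \<epsilon> (int i) \<omega>)" for n k \<omega>
  define T where "T n \<omega> = proj_statistic d lam v n (\<lambda>i. \<eta> n i \<omega>)" for n \<omega>
  define That where
    "That n \<omega> = proj_statistic_hat d (lamh n \<omega>) (vh n \<omega>) n (\<lambda>i. \<eta> n i \<omega>)" for n \<omega>
  have \<eta>_measurable: "\<eta> n i \<in> borel_measurable M" for n i
    unfolding \<eta>_def observation_def by measurable
  obtain c where c: "\<And>x. x \<in> {0..1} \<Longrightarrow> g x = c"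
    using H0 by (auto simp: H0_def constant_on_def)
  have cusum_\<eta>: "cusum n k (\<lambda>i. \<eta> n i \<omega>) = S n k \<omega>" if "k \<in> {1..<n}" for n k \<omega>
    unfolding S_def using that c
    by (intro cusum_add_const[where c = "c *\<^sub>R \<Delta>"]) (auto simp: \<eta>_def observation_def)

  have v: "orthonormal_basis v"
    using C_spectral by (rule spectral_decomposition_basis)
  have C_adj: "self_adjoint C"
    using C_spectral by (rule spectral_decomposition_self_adjoint)
  have \<epsilon>_int: "integrable M (\<lambda>\<omega>. (norm (\<epsilon> i \<omega>))\<^sup>2)" for i
    using \<epsilon>_measurable \<epsilon>_stationary \<epsilon>_square_integrable by (rule strictly_stationary_square_integrable)
  have C_HS: "summable (\<lambda>j. (norm (C (e j)))\<^sup>2)" if "orthonormal_basis e" for e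
    using \<epsilon>_measurable \<epsilon>_int autocov_summable C_adj[unfolded C_def] that unfolding C_def
    by (rule long_run_cov_op_hilbert_schmidt)
  define \<delta> where "\<delta> n \<omega> = hs_norm (\<lambda>x. C x - Chat n \<omega> x)" for n \<omega>
  have sum_le: "(\<Sum>i\<in>F. (norm (C (u i) - Chat n \<omega> (u i)))\<^sup>2) \<le> (\<delta> n \<omega>)\<^sup>2"
    and \<delta>_nonneg: "0 \<le> \<delta> n \<omega>"
    if \<omega>: "\<omega> \<in> space M" and u: "orthonormal u" and F: "finite F" for n \<omega> u F
  proof -
    have adj: "self_adjoint (\<lambda>x. C x - Chat n \<omega> x)"
      using C_adj Chat_self_adjoint[OF \<omega>]
      by (simp add: self_adjoint_def inner_diff_left inner_diff_right)
    have S: "summable (\<lambda>j. (norm (C (e j) - Chat n \<omega> (e j)))\<^sup>2)" if "orthonormal_basis e" for e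
      using C_HS[OF that] Chat_HS[OF \<omega>] that
      by (intro hilbert_schmidt_sum_diff) (auto simp: hilbert_schmidt_def)
    show "(\<Sum>i\<in>F. (norm (C (u i) - Chat n \<omega> (u i)))\<^sup>2) \<le> (\<delta> n \<omega>)\<^sup>2" "0 \<le> \<delta> n \<omega>"
      unfolding \<delta>_def using sum_norm_image_le_hs_norm[OF adj u F v S] by blast+
  qed

  define gap where "gap = lam (d - 1) - lam d"
  have gap: "0 < gap" using ii by (simp add: gap_def)
  define mx where "mx n \<omega> = Max ((\<lambda>k. norm (S n k \<omega>)) ` {1..<n})" for n \<omega>
  \<comment> \<open>The deterministic comparison of the two statistics at one outcome.\<close>
  have close_outside: "ereal (T n \<omega> - s) \<le> That n \<omega> \<and> That n \<omega> \<le> ereal (T n \<omega> + s)"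
    if \<omega>: "\<omega> \<in> space M" and n: "2 \<le> n" and K: "0 < K" "mx n \<omega> \<le> K"
      and \<delta>0: "0 \<le> \<delta>0" "\<delta>0 < gap / 2" "\<delta> n \<omega> \<le> \<delta>0"
      and s: "sqrt \<delta>0 * (2 / gap) * K \<le> s" for \<omega> n K \<delta>0 s
  proof -
    have "(\<delta> n \<omega>)\<^sup>2 \<le> \<delta>0\<^sup>2"
      using \<delta>0(3) \<delta>_nonneg[OF \<omega> orthonormal_basis_orthonormal[OF v] finite.emptyI]
      by (rule power_mono)
    then have sum_le0: "(\<Sum>i\<in>F. (norm (C (u i) - Chat n \<omega> (u i)))\<^sup>2) \<le> \<delta>0\<^sup>2"
      if "orthonormal_basis u" "finite F" for u F
      using sum_le[OF \<omega> orthonormal_basis_orthonormal[OF that(1)] that(2)] order_trans by blast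
    note pert = standardized_scores_perturbation[where C = C and Ch = "Chat n \<omega>" and d = d
        and lam = lam and v = v and lamh = "lamh n \<omega>" and vh = "vh n \<omega>" and \<delta> = \<delta>0,
        OF C_spectral Chat_spectral[OF \<omega>] lam_order
        lam_nonneg lamh_order[OF \<omega>] d sum_le0[OF v]
        sum_le0[OF spectral_decomposition_basis[OF Chat_spectral[OF \<omega>]]] \<delta>0(1) \<delta>0(2)[unfolded gap_def]]
    have pos: "0 < lamh n \<omega> j" if "j < d" for j
      using pert(1) that by blast
    have "\<bar>proj_statistic d (\<lambda>j. \<bar>lamh n \<omega> j\<bar>) (vh n \<omega>) n (\<lambda>i. \<eta> n i \<omega>) - T n \<omega>\<bar> \<le> s"
      unfolding T_def proj_statistic_eq
    proof (rule abs_Max_diff_le)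
      fix k assume k: "k \<in> {1..<n}"
      have "norm (S n k \<omega>) \<le> mx n \<omega>"
        using k unfolding mx_def by (intro Max_ge) auto
      then have "sqrt \<delta>0 * (2 / gap) * norm (S n k \<omega>) \<le> sqrt \<delta>0 * (2 / gap) * K"
        using K(2) gap \<delta>0(1) by (intro mult_left_mono) auto
      then show "\<bar>L2_set (\<lambda>j. cusum n k (\<lambda>i. \<eta> n i \<omega>) \<bullet> vh n \<omega> j / sqrt \<bar>lamh n \<omega> j\<bar>) {..<d} -
          L2_set (\<lambda>j. cusum n k (\<lambda>i. \<eta> n i \<omega>) \<bullet> v j / sqrt (lam j)) {..<d}\<bar> \<le> s"
        using pert(2)[of "S n k \<omega>"] s unfolding cusum_\<eta>[OF k] gap_def by linarith
    qed (use n in auto)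
    moreover have "That n \<omega> = ereal (proj_statistic d (\<lambda>j. \<bar>lamh n \<omega> j\<bar>) (vh n \<omega>) n (\<lambda>i. \<eta> n i \<omega>))"
      using pos by (force simp: That_def proj_statistic_hat_def)
    ultimately show ?thesis by (simp add: abs_le_iff)
  qed

  have \<delta>_measurable [measurable]: "\<delta> n \<in> borel_measurable M" for n
    unfolding \<delta>_def using Chat_measurable by (rule hs_norm_diff_measurable)
  have mx_measurable: "mx n \<in> borel_measurable M" if "2 \<le> n" for n
    unfolding mx_def S_def
  proof (rule borel_measurable_Max)
    show "(\<lambda>\<omega>. norm (cusum n k (\<lambda>i. \<epsilon> (int i) \<omega>))) \<in> borel_measurable M" for k
      by measurable
  qed (use that in auto)
  have T_measurable: "T n \<in> borel_measurable M" if "2 \<le> n" for n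
    unfolding T_def
    by (rule proj_statistic_measurable[where x = "\<eta> n" and lam = "\<lambda>_. lam" and v = "\<lambda>_. v"])
      (use \<eta>_measurable that in auto)
  have lamh_measurable: "(\<lambda>\<omega>. lamh n \<omega> j) \<in> borel_measurable M" if j: "j < d" for n j
  proof (rule eigenvalue_measurable[where A = "Chat n" and u = "\<lambda>\<omega>. vh n \<omega> j" and e = v])
    fix \<omega> assume \<omega>: "\<omega> \<in> space M"
    show "Chat n \<omega> (vh n \<omega> j) \<bullet> vh n \<omega> j = lamh n \<omega> j"
      using spectral_decomposition_eigenvector[OF Chat_spectral[OF \<omega>]]
        spectral_decomposition_basis[OF Chat_spectral[OF \<omega>]]
      by (simp add: orthonormal_basis_def)
  qed (use Chat_measurable Chat_self_adjoint vh_measurable j v in auto)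
  have That_measurable: "That n \<in> borel_measurable M" if n: "2 \<le> n" for n
  proof -
    have stat: "(\<lambda>\<omega>. proj_statistic d (\<lambda>j. \<bar>lamh n \<omega> j\<bar>) (vh n \<omega>) n (\<lambda>i. \<eta> n i \<omega>))
        \<in> borel_measurable M"
    proof (rule proj_statistic_measurable[where x = "\<eta> n" and v = "vh n"
          and lam = "\<lambda>\<omega> j. \<bar>lamh n \<omega> j\<bar>"])
      show "(\<lambda>\<omega>. \<bar>lamh n \<omega> j\<bar>) \<in> borel_measurable M" if "j < d" for j
        using lamh_measurable[OF that] by (rule borel_measurable_abs)
    qed (fact \<eta>_measurable, fact vh_measurable, fact n)
    have "{\<omega> \<in> space M. \<exists>j\<in>{..<d}. lamh n \<omega> j = 0} \<in> sets M"
    proof (rule sets.sets_Collect_finite_Ex)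
      fix j assume "j \<in> {..<d}"
      then have [measurable]: "(\<lambda>\<omega>. lamh n \<omega> j) \<in> borel_measurable M" using lamh_measurable by simp
      show "{\<omega> \<in> space M. lamh n \<omega> j = 0} \<in> sets M" by measurable
    qed simp
    then have "{\<omega> \<in> space M. \<exists>j<d. lamh n \<omega> j = 0} \<in> sets M"
      by (simp only: Bex_def lessThan_iff)
    then show ?thesis
      unfolding That_def proj_statistic_hat_def
      by (rule measurable_If[OF borel_measurable_const borel_measurable_ereal[OF stat]])
  qed

  \<comment> \<open>For \<open>n < 2\<close> the maxima range over the empty set.\<close>
  have ev2: "\<forall>\<^sub>F n in sequentially. 2 \<le> n" by (rule eventually_ge_at_top)
  have "weak_conv (\<lambda>n t. measure M {\<omega> \<in> space M. That n \<omega> \<le> ereal t}) (cdf (distr N borel (bridge_sup d B)))"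
  proof (rule weak_conv_perturbation[OF M])
    show "\<forall>\<^sub>F n in sequentially. T n \<in> borel_measurable M"
      using ev2 T_measurable by (rule eventually_mono)
    show "\<forall>\<^sub>F n in sequentially. That n \<in> borel_measurable M"
      using ev2 That_measurable by (rule eventually_mono)
    have "real_distribution (distr N borel (bridge_sup d B))"
      using N bridge_sup_measurable[OF bridges] by (rule prob_space.real_distribution_distr)
    then show "mono (cdf (distr N borel (bridge_sup d B)))"
      by (intro monoI finite_borel_measure.cdf_nondecreasing real_distribution.finite_borel_measure_M)
    show "weak_conv (\<lambda>n t. measure M {\<omega> \<in> space M. T n \<omega> \<le> t}) (cdf (distr N borel (bridge_sup d B)))"
      unfolding weak_conv_def
    proof (intro allI impI)
      fix t assume "isCont (cdf (distr N borel (bridge_sup d B))) t"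
      then have "(\<lambda>n. cdf (distr M borel (T n)) t) \<longlonglongrightarrow> cdf (distr N borel (bridge_sup d B)) t"
        using iii[OF H0] unfolding weak_conv_m_def weak_conv_def T_def by blast
      moreover have "\<forall>\<^sub>F n in sequentially.
          cdf (distr M borel (T n)) t = measure M {\<omega> \<in> space M. T n \<omega> \<le> t}"
        using ev2
      proof eventually_elim
        case (elim n)
        then show ?case
          using T_measurable by (simp add: cdf_def measure_distr vimage_def Int_def conj_commute)
      qed
      ultimately show "(\<lambda>n. measure M {\<omega> \<in> space M. T n \<omega> \<le> t})
          \<longlonglongrightarrow> cdf (distr N borel (bridge_sup d B)) t"
        by (rule Lim_transform_eventually)
    qed
  next
    fix s p :: real assume s: "0 < s" and p: "0 < p"
    obtain K0 where K0: "\<forall>\<^sub>F n in sequentially. measure M {\<omega> \<in> space M. \<bar>mx n \<omega>\<bar> > K0} < p / 2"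
      using iv[unfolded big_OP_1_def, rule_format, of "p / 2"] p unfolding mx_def S_def by auto
    define K where "K = max K0 1"
    \<comment> \<open>The first bound keeps the eigenvalues separated, the second makes the perturbation bound
      at most \<open>s\<close> when all cumulative sums are at most \<open>K\<close>.\<close>
    define \<delta>0 where "\<delta>0 = min (gap / 4) ((s * gap / (2 * K))\<^sup>2)"
    have K: "0 < K" "K0 \<le> K" by (auto simp: K_def)
    have \<delta>0: "0 < \<delta>0" "\<delta>0 < gap / 2"
      using gap s K by (auto simp: \<delta>0_def)
    have "sqrt \<delta>0 \<le> sqrt ((s * gap / (2 * K))\<^sup>2)"
      by (intro real_sqrt_le_mono) (simp add: \<delta>0_def)
    also have "\<dots> = s * gap / (2 * K)" using s gap K by simp
    finally have "sqrt \<delta>0 * (2 / gap) * K \<le> s * gap / (2 * K) * (2 / gap) * K"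
      using gap K by (intro mult_right_mono) auto
    also have "\<dots> = s" using gap K by (simp add: field_simps)
    finally have small: "sqrt \<delta>0 * (2 / gap) * K \<le> s" .
    have "(\<lambda>n. measure M {\<omega> \<in> space M. \<bar>\<delta> n \<omega>\<bar> > \<delta>0}) \<longlonglongrightarrow> 0"
      using i[unfolded little_oP_1_def] \<delta>0(1) unfolding \<delta>_def by blast
    then have "\<forall>\<^sub>F n in sequentially. measure M {\<omega> \<in> space M. \<bar>\<delta> n \<omega>\<bar> > \<delta>0} < p / 2"
      using p by (intro order_tendstoD) auto
    with K0 ev2 show "\<forall>\<^sub>F n in sequentially. \<exists>E\<in>sets M. measure M E < p \<and>
        (\<forall>\<omega>\<in>space M - E. ereal (T n \<omega> - s) \<le> That n \<omega> \<and> That n \<omega> \<le> ereal (T n \<omega> + s))"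
    proof eventually_elim
      case (elim n)
      note [measurable] = mx_measurable[OF elim(2)]
      let ?E1 = "{\<omega> \<in> space M. \<bar>mx n \<omega>\<bar> > K0}" and ?E2 = "{\<omega> \<in> space M. \<bar>\<delta> n \<omega>\<bar> > \<delta>0}"
      have "measure M (?E1 \<union> ?E2) \<le> measure M ?E1 + measure M ?E2"
        by (rule measure_Un_le) measurable
      then have "measure M (?E1 \<union> ?E2) < p" using elim by simp
      moreover have "?E1 \<union> ?E2 \<in> sets M" by measurable
      moreover have "ereal (T n \<omega> - s) \<le> That n \<omega> \<and> That n \<omega> \<le> ereal (T n \<omega> + s)"
        if "\<omega> \<in> space M - (?E1 \<union> ?E2)" for \<omega>
        using that elim(2) K \<delta>0 small by (intro close_outside[of \<omega> n K \<delta>0]) auto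
      ultimately show ?case by blast
    qed
  qed
  then show ?thesis unfolding conv_in_distribution_def That_def .
qed

end
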